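(* Let $M$ be a matroid on $[n]$. The augmented Chow ring $\widetilde{A}(M)$ of $M$ has the following basis (over $\mathbb{Q}$): $$\widetilde{FY}(M)=\Big\{x_{F_1}^{a_1}x_{F_2}^{a_2}\cdots x_{F_k}^{a_k}:\ \emptyset\subsetneq F_1\subsetneq F_2\subsetneq\cdots\subsetneq F_k,\ \ 1\le a_1\le\mathrm{rk}_M(F_1),\ \ 1\le a_i\le\mathrm{rk}_M(F_i)-\mathrm{rk}_M(F_{i-1})-1\text{ for }i\ge2\Big\},$$ where $k\ge 0$, the $F_i$ are flats of $M$, and $\mathrm{rk}_M$ is the rank function of $M$.
   Context: $M$ has ground set $[n]=\{1,\dots,n\}$ and lattice of flats $\mathcal{L}(M)$. The augmented Chow ring is $$\widetilde A(M)=\mathbb{Q}\big[\{x_F\}_{F\in\mathcal L(M)\setminus\{[n]\}}\cup\{y_1,\dots,y_n\}\big]/(I_1+I_2+I_3),$$ with $I_1=\langle x_Fx_G:F,G\text{ incomparable in }\mathcal L(M)\rangle$, $I_2=\langle y_ix_F:i\notin F\rangle$, $I_3=\langle y_i-\sum_{F\in\mathcal L(M)\setminus\{[n]\},\,i\notin F}x_F:1\le i\le n\rangle$. In $\widetilde A(M)$ the symbol $x_{[n]}$ denotes the element $-\sum_{F\in\mathcal L(M)\setminus\{[n]\}}x_F$ (so $F_k=[n]$ is allowed in the monomials). The case $k=0$ is the monomial $1$. *)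

theory Defs
  imports "HOL-Algebra.Embedded_Algebras" "HOL-Algebra.QuotRing" "HOL-Library.Poly_Mapping"
begin

section \<open>Matroids\<close>

locale matroid =
  fixes E :: "'a set" and indep :: "'a set \<Rightarrow> bool"
  assumes finite_ground: "finite E"
    and indep_subset_ground: "indep X \<Longrightarrow> X \<subseteq> E"
    and indep_empty: "indep {}"
    and indep_subset: "indep X \<Longrightarrow> Y \<subseteq> X \<Longrightarrow> indep Y"
    and augmentation: "indep X \<Longrightarrow> indep Y \<Longrightarrow> card X < card Y
           \<Longrightarrow> \<exists>y\<in>Y - X. indep (insert y X)"

definition mrank :: "('a set \<Rightarrow> bool) \<Rightarrow> 'a set \<Rightarrow> nat"
  where "mrank indep X = Max (card ` {I. I \<subseteq> X \<and> indep I})"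

definition flats :: "'a set \<Rightarrow> ('a set \<Rightarrow> bool) \<Rightarrow> 'a set set"
  where "flats E indep =
    {F. F \<subseteq> E \<and> (\<forall>e\<in>E - F. mrank indep F < mrank indep (insert e F))}"

section \<open>Polynomial rings\<close>

text \<open>
  A monomial is a finitely supported exponent function, and a polynomial a finitely supported
  function from monomials to coefficients; multiplication on this type is convolution.
  \<open>mpoly_ring V\<close> is the ring of rational polynomials in the variables \<open>V\<close> only.
\<close>

type_synonym 'v mpoly_rat = "('v \<Rightarrow>\<^sub>0 nat) \<Rightarrow>\<^sub>0 rat"

definition mpoly_ring :: "'v set \<Rightarrow> 'v mpoly_rat ring"
  where "mpoly_ring V =
    \<lparr>carrier = {p. \<forall>m\<in>Poly_Mapping.keys p. Poly_Mapping.keys m \<subseteq> V},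
     mult = (*), one = 1, zero = 0, add = (+)\<rparr>"

definition mconst :: "rat \<Rightarrow> 'v mpoly_rat"
  where "mconst c = Poly_Mapping.single 0 c"

definition mvar :: "'v \<Rightarrow> 'v mpoly_rat"
  where "mvar v = Poly_Mapping.single (Poly_Mapping.single v 1) 1"

section \<open>The augmented Chow ring\<close>

datatype 'a aug_var = XVar "'a set" | YVar 'a

definition aug_vars :: "'a set \<Rightarrow> ('a set \<Rightarrow> bool) \<Rightarrow> 'a aug_var set"
  where "aug_vars E indep = XVar ` (flats E indep - {E}) \<union> YVar ` E"

definition aug_poly_ring :: "'a set \<Rightarrow> ('a set \<Rightarrow> bool) \<Rightarrow> 'a aug_var mpoly_rat ring"
  where "aug_poly_ring E indep = mpoly_ring (aug_vars E indep)"

definition aug_ideal1 :: "'a set \<Rightarrow> ('a set \<Rightarrow> bool) \<Rightarrow> 'a aug_var mpoly_rat set"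
  where "aug_ideal1 E indep = genideal (aug_poly_ring E indep)
    {mvar (XVar F) * mvar (XVar G) |F G.
       F \<in> flats E indep - {E} \<and> G \<in> flats E indep - {E} \<and> \<not> F \<subseteq> G \<and> \<not> G \<subseteq> F}"

definition aug_ideal2 :: "'a set \<Rightarrow> ('a set \<Rightarrow> bool) \<Rightarrow> 'a aug_var mpoly_rat set"
  where "aug_ideal2 E indep = genideal (aug_poly_ring E indep)
    {mvar (YVar i) * mvar (XVar F) |i F. i \<in> E \<and> F \<in> flats E indep - {E} \<and> i \<notin> F}"

definition aug_ideal3 :: "'a set \<Rightarrow> ('a set \<Rightarrow> bool) \<Rightarrow> 'a aug_var mpoly_rat set"
  where "aug_ideal3 E indep = genideal (aug_poly_ring E indep)
    {mvar (YVar i) - (\<Sum>F\<in>{F \<in> flats E indep - {E}. i \<notin> F}. mvar (XVar F)) |i. i \<in> E}"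

definition aug_ideal :: "'a set \<Rightarrow> ('a set \<Rightarrow> bool) \<Rightarrow> 'a aug_var mpoly_rat set"
  where "aug_ideal E indep =
    aug_ideal1 E indep <+>\<^bsub>aug_poly_ring E indep\<^esub> aug_ideal2 E indep
      <+>\<^bsub>aug_poly_ring E indep\<^esub> aug_ideal3 E indep"

definition aug_chow_ring :: "'a set \<Rightarrow> ('a set \<Rightarrow> bool) \<Rightarrow> 'a aug_var mpoly_rat set ring"
  where "aug_chow_ring E indep = aug_poly_ring E indep Quot aug_ideal E indep"

definition aug_class ::
    "'a set \<Rightarrow> ('a set \<Rightarrow> bool) \<Rightarrow> 'a aug_var mpoly_rat \<Rightarrow> 'a aug_var mpoly_rat set"
  where "aug_class E indep p = aug_ideal E indep +>\<^bsub>aug_poly_ring E indep\<^esub> p"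

definition aug_scalars :: "'a set \<Rightarrow> ('a set \<Rightarrow> bool) \<Rightarrow> 'a aug_var mpoly_rat set set"
  where "aug_scalars E indep = range (\<lambda>c. aug_class E indep (mconst c))"

text \<open>The ground set is not an index of a variable; its generator is an element of the quotient.\<close>

definition aug_x ::
    "'a set \<Rightarrow> ('a set \<Rightarrow> bool) \<Rightarrow> 'a set \<Rightarrow> 'a aug_var mpoly_rat set"
  where "aug_x E indep F =
    (if F = E
     then \<ominus>\<^bsub>aug_chow_ring E indep\<^esub>
            (\<Oplus>\<^bsub>aug_chow_ring E indep\<^esub>G\<in>flats E indep - {E}. aug_class E indep (mvar (XVar G)))
     else aug_class E indep (mvar (XVar F)))"

section \<open>The Feichtner--Yuzvinsky monomials\<close>

text \<open>
  The list \<open>[(F\<^sub>1, a\<^sub>1), \<dots>, (F\<^sub>k, a\<^sub>k)]\<close> stands for the monomial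
  \<open>x\<^bsub>F\<^sub>1\<^esub> ^ a\<^sub>1 \<cdots> x\<^bsub>F\<^sub>k\<^esub> ^ a\<^sub>k\<close>; list positions start at \<open>0\<close>.  Truncation of the
  subtraction on \<open>nat\<close> is harmless, since all exponents are required to be positive.
\<close>

definition FY_data :: "'a set \<Rightarrow> ('a set \<Rightarrow> bool) \<Rightarrow> ('a set \<times> nat) list set"
  where "FY_data E indep =
    {ps. (\<forall>(F, a)\<in>set ps. F \<in> flats E indep \<and> 1 \<le> a)
       \<and> (ps \<noteq> [] \<longrightarrow> {} \<subset> fst (ps ! 0) \<and> snd (ps ! 0) \<le> mrank indep (fst (ps ! 0)))
       \<and> (\<forall>i. Suc i < length ps \<longrightarrow>
            fst (ps ! i) \<subset> fst (ps ! Suc i)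
          \<and> snd (ps ! Suc i)
              \<le> mrank indep (fst (ps ! Suc i)) - mrank indep (fst (ps ! i)) - 1)}"

definition FY_monomial ::
    "'a set \<Rightarrow> ('a set \<Rightarrow> bool) \<Rightarrow> ('a set \<times> nat) list \<Rightarrow> 'a aug_var mpoly_rat set"
  where "FY_monomial E indep ps =
    foldr (\<lambda>(F, a) r. (aug_x E indep F [^]\<^bsub>aug_chow_ring E indep\<^esub> a)
                        \<otimes>\<^bsub>aug_chow_ring E indep\<^esub> r)
      ps \<one>\<^bsub>aug_chow_ring E indep\<^esub>"

definition FY :: "'a set \<Rightarrow> ('a set \<Rightarrow> bool) \<Rightarrow> 'a aug_var mpoly_rat set set"
  where "FY E indep = FY_monomial E indep ` FY_data E indep"

section \<open>Finite bases\<close>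

text \<open>
  \<^const>\<open>ring.independent\<close> and \<^const>\<open>ring.Span\<close> speak about lists of vectors; the order of the
  list is irrelevant when \<open>K\<close> is a subfield of \<open>R\<close>.
\<close>

definition is_basis_over :: "('b, 'c) ring_scheme \<Rightarrow> 'b set \<Rightarrow> 'b set \<Rightarrow> bool"
  where "is_basis_over R K B \<longleftrightarrow>
    (\<exists>bs. distinct bs \<and> set bs = B \<and> ring.independent R K bs \<and> ring.Span R K bs = carrier R)"

end

theory Submission
  imports Defs "HOL-Library.Multiset"
begin

text \<open>
  Put \<open>h\<^sub>G\<close> for the sum of the \<open>x\<^sub>H\<close> with \<open>G \<subseteq> H\<close>.  If \<open>G\<close> covers \<open>G'\<close>, then
  \<open>h\<^sub>G h\<^bsub>G'\<^esub> = h\<^sub>G\<^sup>2\<close>; hence \<open>x\<^sub>F h\<^sub>G ^ (rk G - rk F) = 0\<close> for \<open>F \<subset> G\<close> and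
  \<open>h\<^sub>G ^ (rk G + 1) = 0\<close>.  Expanding these relations rewrites every other monomial into monomials of
  the same degree with a larger sum of ranks, which gives spanning.

  For independence, the degree map sends a monomial \<open>h\<^bsub>G\<^sub>1\<^esub> \<cdots> h\<^bsub>G\<^sub>r\<^esub>\<close> with \<open>r = rk E\<close> to \<open>1\<close> if
  \<open>G\<^sub>1, \<dots>, G\<^sub>r\<close> have a transversal that is a basis of the matroid, and to \<open>0\<close> otherwise.  Multiplication
  by \<open>h\<^sub>G\<close> corresponds to the principal truncation along \<open>G\<close>, and for a monomial \<open>m\<close> of degree
  \<open>r - 1\<close> the degree of \<open>x\<^sub>F m\<close> only depends on whether \<open>F\<close> is \<open>E\<close> or the set of loops of the matroid
  truncated along \<open>m\<close>; therefore the degree map kills the defining relations.  A Feichtner--Yuzvinsky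
  monomial on the chain \<open>F\<^sub>1 \<subset> \<dots> \<subset> F\<^sub>k\<close> is tested against the product of the \<open>x\<^bsub>F\<^sub>i\<^esub>\<close> with
  \<open>F\<^sub>i \<noteq> E\<close> and of powers of the \<open>h\<^bsub>F\<^sub>i\<^esub>\<close> and \<open>h\<^sub>E\<close>; the resulting pairing is triangular for the sum of ranks.
\<close>

section \<open>Matroid rank and principal truncation\<close>

context matroid
begin

abbreviation rk :: "'a set \<Rightarrow> nat" where "rk \<equiv> mrank indep"
abbreviation L :: "'a set set" where "L \<equiv> flats E indep"

lemma indep_finite: "indep I \<Longrightarrow> finite I"
  using finite_ground finite_subset indep_subset_ground by blast

lemma finite_indeps: "finite {I. I \<subseteq> X \<and> indep I}"
  by (rule finite_subset[of _ "Pow E"]) (use finite_ground indep_subset_ground in auto)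

lemma rk_ge: "I \<subseteq> X \<Longrightarrow> indep I \<Longrightarrow> card I \<le> rk X"
  unfolding mrank_def by (rule Max_ge) (auto simp: finite_indeps)

lemma rk_obtain:
  obtains I where "I \<subseteq> X" "indep I" "card I = rk X"
proof -
  have "rk X \<in> card ` {I. I \<subseteq> X \<and> indep I}"
    unfolding mrank_def by (rule Max_in) (use finite_indeps indep_empty in auto)
  then show ?thesis using that by auto
qed

lemma indep_extend:
  assumes "indep I" "I \<subseteq> X"
  obtains J where "I \<subseteq> J" "J \<subseteq> X" "indep J" "card J = rk X"
proof -
  have "\<exists>J. I \<subseteq> J \<and> J \<subseteq> X \<and> indep J \<and> card J = rk X"
    using assms
  proof (induction "rk X - card I" arbitrary: I)
    case 0
    then have "card I = rk X" using rk_ge[of I X] by auto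
    then show ?case using 0 by auto
  next
    case (Suc k)
    obtain B where B: "B \<subseteq> X" "indep B" "card B = rk X" by (rule rk_obtain)
    then have "card I < card B" using Suc(2) by simp
    from augmentation[OF Suc(3) B(2) this]
    obtain y where y: "y \<in> B - I" "indep (insert y I)" by blast
    have "card (insert y I) = Suc (card I)" using y indep_finite[OF Suc(3)] by auto
    then have "k = rk X - card (insert y I)" using Suc(2) by auto
    from Suc(1)[OF this y(2)] show ?case using y B Suc(4) by blast
  qed
  then show ?thesis using that by blast
qed

lemma rk_mono: "A \<subseteq> B \<Longrightarrow> rk A \<le> rk B"
  by (metis rk_ge rk_obtain subset_trans)

lemma rk_empty [simp]: "rk {} = 0"
  using rk_obtain[of "{}"] by (metis card.empty subset_empty)

lemma rk_submodular: "rk (A \<union> B) + rk (A \<inter> B) \<le> rk A + rk B"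
proof -
  obtain I where I: "I \<subseteq> A \<inter> B" "indep I" "card I = rk (A \<inter> B)" by (rule rk_obtain)
  then obtain J where J: "I \<subseteq> J" "J \<subseteq> A \<union> B" "indep J" "card J = rk (A \<union> B)"
    using indep_extend[of I "A \<union> B"] by blast
  have fin: "finite J" using J indep_finite by blast
  have "card (J \<inter> A) \<le> rk A" "card (J \<inter> B) \<le> rk B"
    using J indep_subset by (auto intro!: rk_ge)
  moreover have "card (J \<inter> A) + card (J \<inter> B) = card J + card (J \<inter> A \<inter> (J \<inter> B))"
    using card_Un_Int[of "J \<inter> A" "J \<inter> B"] fin J(2) by (simp add: Int_absorb2 Int_Un_distrib[symmetric])
  moreover have "card I \<le> card (J \<inter> A \<inter> (J \<inter> B))"
    using I J fin by (intro card_mono) auto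
  ultimately show ?thesis using I J by linarith
qed

lemma rk_insert: "rk (insert e A) \<le> Suc (rk A)"
proof -
  obtain I where I: "I \<subseteq> {e}" "indep I" "card I = rk {e}" by (rule rk_obtain)
  then have "rk {e} \<le> 1" using card_mono[of "{e}" I] by simp
  then show ?thesis using rk_submodular[of "{e}" A] by (simp del: insert_is_Un)
qed

section \<open>Flats and the closure operator\<close>

lemma finite_L: "finite L"
  by (rule finite_subset[of _ "Pow E"]) (use finite_ground in \<open>auto simp: flats_def\<close>)

lemma L_subset: "F \<in> L \<Longrightarrow> F \<subseteq> E"
  by (auto simp: flats_def)

lemma E_in_L [simp]: "E \<in> L"
  by (auto simp: flats_def)

lemma flat_mem: "F \<in> L \<Longrightarrow> e \<in> E \<Longrightarrow> rk (insert e F) \<le> rk F \<Longrightarrow> e \<in> F"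
  by (force simp: flats_def)

lemma flat_rk_less:
  assumes "F \<in> L" "F \<subset> G" "G \<subseteq> E"
  shows "rk F < rk G"
proof -
  obtain e where e: "e \<in> G - F" using assms by blast
  then have "rk F < rk (insert e F)" using assms by (auto simp: flats_def)
  also have "\<dots> \<le> rk G" by (rule rk_mono) (use e assms in auto)
  finally show ?thesis .
qed

lemma flat_eqI: "F \<in> L \<Longrightarrow> G \<in> L \<Longrightarrow> F \<subseteq> G \<Longrightarrow> rk G \<le> rk F \<Longrightarrow> F = G"
  using flat_rk_less[of F G] L_subset by force

definition cl :: "'a set \<Rightarrow> 'a set" where "cl S = {e \<in> E. rk (insert e S) = rk S}"

lemma subset_cl: "S \<subseteq> E \<Longrightarrow> S \<subseteq> cl S"
  by (auto simp: cl_def insert_absorb)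

lemma cl_subset_E: "cl S \<subseteq> E"
  by (auto simp: cl_def)

lemma rk_Un_eq:
  assumes "finite T" "\<And>e. e \<in> T \<Longrightarrow> rk (insert e S) = rk S"
  shows "rk (S \<union> T) = rk S"
  using assms
proof (induction T)
  case empty
  then show ?case by simp
next
  case (insert e T)
  have "rk ((S \<union> T) \<union> insert e S) + rk ((S \<union> T) \<inter> insert e S) \<le> rk (S \<union> T) + rk (insert e S)"
    by (rule rk_submodular)
  moreover have "rk S \<le> rk ((S \<union> T) \<inter> insert e S)" by (rule rk_mono) auto
  moreover have "(S \<union> T) \<union> insert e S = S \<union> insert e T" by auto
  moreover have "rk S \<le> rk (S \<union> insert e T)" by (rule rk_mono) auto
  ultimately show ?case using insert by simp
qed

lemma rk_cl:
  assumes "S \<subseteq> E" shows "rk (cl S) = rk S"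
proof -
  have "rk (S \<union> cl S) = rk S"
    by (rule rk_Un_eq) (use finite_ground finite_subset cl_subset_E in \<open>auto simp: cl_def\<close>)
  then show ?thesis using subset_cl[OF assms] by (simp add: Un_absorb1)
qed

lemma cl_in_L:
  assumes "S \<subseteq> E" shows "cl S \<in> L"
proof -
  have "e \<in> cl S" if "e \<in> E" "rk (insert e (cl S)) \<le> rk (cl S)" for e
  proof -
    have "rk (insert e S) \<le> rk (insert e (cl S))" by (rule rk_mono) (use subset_cl[OF assms] in auto)
    then have "rk (insert e S) \<le> rk S" using that rk_cl[OF assms] by simp
    moreover have "rk S \<le> rk (insert e S)" by (rule rk_mono) auto
    ultimately show ?thesis using that by (simp add: cl_def)
  qed
  then show ?thesis using cl_subset_E by (force simp: flats_def not_less)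
qed

lemma cl_subset_flat:
  assumes "S \<subseteq> F" "F \<in> L" shows "cl S \<subseteq> F"
proof
  fix e assume e: "e \<in> cl S"
  have "rk (F \<union> insert e S) + rk (F \<inter> insert e S) \<le> rk F + rk (insert e S)" by (rule rk_submodular)
  moreover have "rk S \<le> rk (F \<inter> insert e S)" by (rule rk_mono) (use assms in auto)
  moreover have "F \<union> insert e S = insert e F" using assms by auto
  ultimately show "e \<in> F" using e flat_mem[OF assms(2)] by (simp add: cl_def)
qed

lemma cl_subset_flat_iff: "S \<subseteq> E \<Longrightarrow> F \<in> L \<Longrightarrow> cl S \<subseteq> F \<longleftrightarrow> S \<subseteq> F"
  using cl_subset_flat subset_cl by blast

lemma rk_cl_insert:
  assumes "F \<in> L" "e \<in> E - F" shows "rk (cl (insert e F)) = Suc (rk F)"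
proof -
  have "rk F < rk (insert e F)" using assms by (auto simp: flats_def)
  then show ?thesis using rk_insert[of e F] rk_cl[of "insert e F"] assms L_subset by force
qed

text \<open>Principal truncation: the rank drops by one on the sets whose closure contains \<open>G\<close>.
  A negative value of \<open>trk m\<close> at \<open>{}\<close> records a truncation along a set of loops.\<close>

definition trunc :: "'a set \<Rightarrow> ('a set \<Rightarrow> int) \<Rightarrow> 'a set \<Rightarrow> int"
  where "trunc G \<rho> S = min (\<rho> S) (\<rho> (S \<union> G) - 1)"

text \<open>Unfolded, \<open>trk m S\<close> is the minimum over the submultisets \<open>s\<close>
  of \<open>m\<close> of the rank of the union of \<open>S\<close> with all members of
  \<open>s\<close>, minus \<open>size s\<close>. Hence \<open>0 \<le> trk m {}\<close> is the
  condition of Rado's theorem for the family \<open>m\<close> to have an independent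
  transversal.\<close>

definition trk :: "'a set multiset \<Rightarrow> 'a set \<Rightarrow> int"
  where "trk m = fold_mset trunc (\<lambda>S. int (rk S)) m"

text \<open>Truncating along \<open>G\<close> and \<open>H\<close> in either order gives the minimum
  of the values at \<open>S\<close>, \<open>S \<union> G\<close>, \<open>S \<union> H\<close> and
  \<open>S \<union> G \<union> H\<close>, lowered by 0, 1, 1 and 2. This makes the fold over a
  multiset meaningful.\<close>

lemma comp_fun_commute_trunc: "comp_fun_commute trunc"
  by standard (auto simp: trunc_def fun_eq_iff Un_ac min_def)

lemma trk_empty [simp]: "trk {#} S = int (rk S)"
  by (simp add: trk_def)

lemma trk_add: "trk (add_mset G m) S = min (trk m S) (trk m (S \<union> G) - 1)"
  by (simp add: trk_def comp_fun_commute.fold_mset_add_mset[OF comp_fun_commute_trunc] trunc_def)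

lemma trk_mono: "A \<subseteq> B \<Longrightarrow> trk m A \<le> trk m B"
proof (induction m arbitrary: A B)
  case empty
  then show ?case by (simp add: rk_mono)
next
  case (add G m)
  have "A \<union> G \<subseteq> B \<union> G" using add.prems by auto
  then show ?case using add.IH[OF add.prems] add.IH[of "A \<union> G" "B \<union> G"]
    by (simp add: trk_add min_def)
qed

text \<open>Each value on the right-hand side is attained at the set itself or at its union with the
  new member \<open>G\<close>. The four combinations are bounded by the induction hypothesis for the
  corresponding pair of sets, up to monotonicity.\<close>

lemma trk_submodular: "trk m (A \<union> B) + trk m (A \<inter> B) \<le> trk m A + trk m B"
proof (induction m arbitrary: A B)
  case empty
  then show ?case using rk_submodular[of A B] by simp
next
  case (add G m)
  have 1: "trk m (A \<union> B) + trk m (A \<inter> B) \<le> trk m A + trk m B" by (rule add)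
  have "A \<union> (B \<union> G) = A \<union> B \<union> G" "A \<union> G \<union> B = A \<union> B \<union> G"
    "A \<union> G \<union> (B \<union> G) = A \<union> B \<union> G" "(A \<union> G) \<inter> (B \<union> G) = A \<inter> B \<union> G"
    by auto
  then have 2: "trk m (A \<union> B \<union> G) + trk m (A \<inter> B) \<le> trk m A + trk m (B \<union> G)"
    and 3: "trk m (A \<union> B \<union> G) + trk m (A \<inter> B) \<le> trk m (A \<union> G) + trk m B"
    and 4: "trk m (A \<union> B \<union> G) + trk m (A \<inter> B \<union> G) \<le> trk m (A \<union> G) + trk m (B \<union> G)"
    using le_supI1[OF inf_le2[of A B]] le_supI1[OF inf_le1[of A B]] add[of A "B \<union> G"] trk_mono[of "A \<inter> B" "A \<inter> (B \<union> G)" m]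
      add[of "A \<union> G" B] trk_mono[of "A \<inter> B" "(A \<union> G) \<inter> B" m]
      add[of "A \<union> G" "B \<union> G"] by auto
  show ?case using 1 2 3 4 by (auto simp: trk_add min_def)
qed

text \<open>A principal truncation is a matroid quotient, so rank increments only shrink. If the
  minimum at \<open>A\<close> comes from \<open>A \<union> G\<close>, submodularity for
  \<open>B\<close> and \<open>A \<union> G\<close> compares the increments.\<close>

lemma trk_quotient:
  assumes "A \<subseteq> B" shows "trk m B - trk m A \<le> int (rk B) - int (rk A)"
  using assms
proof (induction m arbitrary: A B)
  case empty
  then show ?case by simp
next
  case (add G m)
  have "trk m (B \<union> G) + trk m A \<le> trk m B + trk m (A \<union> G)"
  proof -
    have "B \<union> (A \<union> G) = B \<union> G" using add.prems by auto
    then show ?thesis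
      using trk_submodular[of m B "A \<union> G"] trk_mono[of A "B \<inter> (A \<union> G)" m] add.prems by auto
  qed
  then show ?case using add.IH[OF add.prems] by (auto simp: trk_add min_def)
qed

lemma trk_add_le: "trk (m + s) S \<le> trk m S"
  by (induction s) (auto simp: trk_add)

lemma trk_add_mset_le: "trk (add_mset G m) S \<le> trk m S"
  by (simp add: trk_add)

lemma trk_le_rk: "trk m S \<le> int (rk S)"
  by (induction m) (auto simp: trk_add)

lemma trk_empty_le: "trk m {} \<le> 0"
  using trk_le_rk[of m "{}"] by simp

lemma trk_add_le_size:
  assumes "\<And>G. G \<in># s \<Longrightarrow> G \<subseteq> S"
  shows "trk (m + s) S \<le> trk m S - int (size s)"
  using assms
proof (induction s)
  case (add G s)
  then have "trk (m + s) (S \<union> G) = trk (m + s) S" by (simp add: Un_absorb2)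
  then show ?case using add by (simp add: trk_add)
qed auto

lemma trk_contained:
  assumes "\<And>G. G \<in># s \<Longrightarrow> G \<subseteq> S"
  shows "trk s S = int (rk S) - int (size s)"
  using assms
proof (induction s)
  case (add G s)
  then have "S \<union> G = S" by auto
  then show ?case using add by (simp add: trk_add)
qed auto

lemma trk_overfull: "\<lbrakk>\<And>G. G \<in># s \<Longrightarrow> G \<subseteq> S; rk S < size s\<rbrakk> \<Longrightarrow> trk (m + s) {} < 0"
  using trk_contained[of s S] trk_add_le[of s m S] trk_mono[of "{}" S "m + s"]
  by (simp add: add.commute)

section \<open>Loops of the truncated matroid\<close>

definition loops :: "'a set \<Rightarrow> 'a set multiset \<Rightarrow> 'a set"
  where "loops F m = {e \<in> F. trk m {e} \<le> 0}"

text \<open>Loops are added one at a time by submodularity; \<open>trk m {} = 0\<close> keeps the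
  values at the intersections nonnegative.\<close>

lemma trk_le_0:
  assumes "trk m {} = 0" "finite S" "\<And>e. e \<in> S \<Longrightarrow> trk m {e} \<le> 0"
  shows "trk m S \<le> 0"
  using assms(2,3)
proof (induction S)
  case empty
  then show ?case using assms(1) by simp
next
  case (insert e S)
  have "trk m ({e} \<union> S) + trk m ({e} \<inter> S) \<le> trk m {e} + trk m S" by (rule trk_submodular)
  moreover have "trk m ({e} \<inter> S) \<ge> 0" using trk_mono[of "{}" "{e} \<inter> S" m] assms(1) by simp
  ultimately show ?case using insert by force
qed

lemma subset_loops_iff:
  assumes "trk m {} = 0" "S \<subseteq> F" "F \<subseteq> E"
  shows "S \<subseteq> loops F m \<longleftrightarrow> trk m S \<le> 0"
proof
  assume "S \<subseteq> loops F m"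
  then show "trk m S \<le> 0"
    using trk_le_0[OF assms(1) finite_subset[OF subset_trans[OF assms(2,3)] finite_ground]]
    by (auto simp: loops_def)
next
  assume *: "trk m S \<le> 0"
  show "S \<subseteq> loops F m"
  proof
    fix e assume e: "e \<in> S"
    then have "trk m {e} \<le> trk m S" by (intro trk_mono) auto
    then show "e \<in> loops F m" using e assms(2) * by (auto simp: loops_def)
  qed
qed

text \<open>The loops of a quotient form a flat of the original matroid: an element that does not
  raise the rank of the loop set does not raise its truncated rank either, by
  \<open>trk_quotient\<close>, and is therefore a loop.\<close>

lemma loops_in_L:
  assumes "trk m {} = 0" "F \<in> L"
  shows "loops F m \<in> L"
proof -
  let ?T = "loops F m"
  have T: "?T \<subseteq> F" by (auto simp: loops_def)
  have FE: "F \<subseteq> E" using assms L_subset by auto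
  have "e \<in> ?T" if "e \<in> E" "rk (insert e ?T) \<le> rk ?T" for e
  proof -
    have "rk ?T = rk (insert e ?T)" using that rk_mono[of ?T "insert e ?T"] by auto
    then have "e \<in> cl ?T" using that by (simp add: cl_def)
    then have eF: "e \<in> F" using cl_subset_flat[OF T assms(2)] by auto
    have "trk m (insert e ?T) \<le> trk m ?T"
      using trk_quotient[OF subset_insertI[of ?T e], of m] that by linarith
    also have "\<dots> \<le> 0" using subset_loops_iff[OF assms(1) T FE] by simp
    finally have "insert e ?T \<subseteq> ?T"
      using subset_loops_iff[OF assms(1) _ FE, of "insert e ?T"] T eF by auto
    then show ?thesis by auto
  qed
  then show ?thesis using T FE unfolding flats_def by (force simp: not_less)
qed

text \<open>Truncating along a set \<open>G\<close> not contained in the final loop set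
  \<open>F\<close> cannot be what made \<open>F\<close> a set of loops: after this truncation
  \<open>F \<union> G\<close> still has value at least 1, so at least 2 before it, and the value at
  \<open>F\<close> was at most 0 already.\<close>

lemma trk_loops_strip:
  assumes "trk (z + s) {} = 0" "F' \<subseteq> E" "F = loops F' (z + s)"
    and "\<And>G. G \<in># s \<Longrightarrow> G \<subseteq> F' \<and> \<not> G \<subseteq> F" "0 \<le> trk z {}"
  shows "trk z F \<le> 0"
  using assms
proof (induction s)
  case empty
  then show ?case using subset_loops_iff[of z F F'] by (auto simp: loops_def)
next
  case (add G s)
  let ?a = "z + s"
  have F: "F \<subseteq> F'" using add.prems(3) by (auto simp: loops_def)
  have G: "G \<subseteq> F'" "\<not> G \<subseteq> F" using add.prems(4)[of G] by auto
  have a0: "trk ?a {} = 0"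
  proof (rule antisym)
    show "trk ?a {} \<le> 0" by (rule trk_empty_le)
    show "0 \<le> trk ?a {}" using trk_add_mset_le[of G ?a "{}"] add.prems(1) by simp
  qed
  have le: "trk (add_mset G ?a) S \<le> trk ?a S" for S by (rule trk_add_mset_le)
  have 0: "trk (add_mset G ?a) F \<le> 0"
    using subset_loops_iff[of "z + add_mset G s" F F'] add.prems F by auto
  have "\<not> F \<union> G \<subseteq> F" using G by auto
  then have "1 \<le> trk (add_mset G ?a) (F \<union> G)"
    using subset_loops_iff[of "z + add_mset G s" "F \<union> G" F'] add.prems F G by auto
  then have "2 \<le> trk ?a (F \<union> G)" by (simp add: trk_add Un_assoc)
  then have "trk ?a F \<le> 0" using 0 by (simp add: trk_add)
  then have "F \<subseteq> loops F' ?a" using subset_loops_iff[OF a0 F add.prems(2)] by simp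
  moreover have "loops F' ?a \<subseteq> F"
    unfolding add.prems(3) using le by (auto simp: loops_def intro: order_trans)
  ultimately have "F = loops F' ?a" by auto
  then show ?case using add.IH a0 add.prems by auto
qed

end

section \<open>The degree map\<close>

lemma poly_mapping_sum_singles:
  "(p :: 'k \<Rightarrow>\<^sub>0 'b::comm_monoid_add) = (\<Sum>m\<in>Poly_Mapping.keys p. Poly_Mapping.single m (Poly_Mapping.lookup p m))"
  by (rule poly_mapping_eqI)
    (auto simp: lookup_sum lookup_single when_def not_in_keys_iff_lookup_eq_zero)

text \<open>Serves twice: for the degree map, with rational values, and for evaluating polynomials,
  with values in another polynomial ring whose constants are embedded by \<open>c\<close>.\<close>

locale linear_extension =
  fixes c :: "rat \<Rightarrow> 'r::comm_ring_1" and \<phi> :: "'k \<Rightarrow> 'r"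
  assumes c_add: "c (a + b) = c a + c b"
    and c_mult: "c (a * b) = c a * c b"
begin

definition ext :: "('k \<Rightarrow>\<^sub>0 rat) \<Rightarrow> 'r"
  where "ext p = (\<Sum>m\<in>Poly_Mapping.keys p. c (Poly_Mapping.lookup p m) * \<phi> m)"

lemma c_0: "c 0 = 0"
  using c_add[of 0 0] by simp

lemma ext_add: "ext (p + q) = ext p + ext q"
  unfolding ext_def by (rule setsum_keys_plus_distrib) (auto simp: c_0 c_add algebra_simps)

lemma ext_0 [simp]: "ext 0 = 0"
  by (simp add: ext_def)

lemma ext_uminus: "ext (- p) = - ext p"
  using ext_add[of p "- p"] by (simp add: eq_neg_iff_add_eq_0 add.commute)

lemma ext_diff: "ext (p - q) = ext p - ext q"
  using ext_add[of p "- q"] by (simp add: ext_uminus)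

lemma ext_sum: "ext (\<Sum>i\<in>A. f i) = (\<Sum>i\<in>A. ext (f i))"
  by (induction A rule: infinite_finite_induct) (auto simp: ext_add)

lemma ext_single: "ext (Poly_Mapping.single m a) = c a * \<phi> m"
  by (cases "a = 0") (auto simp: ext_def c_0)

end

locale multiplicative_extension = linear_extension c \<phi>
  for c :: "rat \<Rightarrow> 'r::comm_ring_1" and \<phi> :: "'k::comm_monoid_add \<Rightarrow> 'r" +
  assumes \<phi>_add: "\<phi> (m + n) = \<phi> m * \<phi> n"
begin

lemma ext_mult: "ext (p * q) = ext p * ext q"
proof -
  have "ext (p * q) = ext ((\<Sum>m\<in>Poly_Mapping.keys p. Poly_Mapping.single m (Poly_Mapping.lookup p m))
     * (\<Sum>n\<in>Poly_Mapping.keys q. Poly_Mapping.single n (Poly_Mapping.lookup q n)))"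
    using poly_mapping_sum_singles by metis
  also have "\<dots> = (\<Sum>m\<in>Poly_Mapping.keys p. \<Sum>n\<in>Poly_Mapping.keys q.
     c (Poly_Mapping.lookup p m) * \<phi> m * (c (Poly_Mapping.lookup q n) * \<phi> n))"
    by (simp add: sum_product ext_sum mult_single ext_single c_mult \<phi>_add mult_ac)
  also have "\<dots> = ext p * ext q"
    unfolding ext_def by (simp add: sum_product)
  finally show ?thesis .
qed

end

section \<open>Polynomials in the h_G and Moebius inversion over the flats\<close>

type_synonym 'a hpoly = "'a set multiset \<Rightarrow>\<^sub>0 rat"

definition hmon :: "'a set multiset \<Rightarrow> 'a hpoly"
  where "hmon m = Poly_Mapping.single m 1"

lemma hmon_add: "hmon (m + n) = hmon m * hmon n"
  by (simp add: hmon_def mult_single)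

lemma hmon_empty [simp]: "hmon {#} = 1"
  using single_one[where ?'a = "'a set multiset" and ?'b = rat] by (simp add: hmon_def zero_multiset_def)

context matroid
begin

text \<open>The value 0 at rank 0 makes the sum of all \<open>xh F\<close> over \<open>L\<close>
  vanish, because this sum is \<open>hvar (cl {})\<close>. This mirrors the choice of x_[n].\<close>

definition hvar :: "'a set \<Rightarrow> 'a hpoly"
  where "hvar G = (if rk G = 0 then 0 else hmon {#G#})"

text \<open>Moebius inversion: \<open>xh\<close> is chosen such that \<open>hvar G\<close> is the sum of all \<open>xh H\<close> with
  \<open>G \<subseteq> H\<close>.\<close>

function xh :: "'a set \<Rightarrow> 'a hpoly"
  where "xh G = hvar G - (\<Sum>H\<in>{H \<in> L. G \<subset> H}. xh H)"
  by auto
termination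
proof (relation "measure (\<lambda>G. card (E - G))")
  fix G H assume "H \<in> {H \<in> L. G \<subset> H}"
  then have "E - H \<subset> E - G" using L_subset by blast
  then show "(H, G) \<in> measure (\<lambda>G. card (E - G))"
    using finite_ground by (simp add: psubset_card_mono)
qed auto

declare xh.simps [simp del]

lemma flat_induct [consumes 1, case_names step]:
  assumes "G \<in> L"
    and "\<And>G. G \<in> L \<Longrightarrow> (\<And>H. H \<in> L \<Longrightarrow> G \<subset> H \<Longrightarrow> P H) \<Longrightarrow> P G"
  shows "P G"
  using assms(1)
proof (induction "card (E - G)" arbitrary: G rule: less_induct)
  case less
  show ?case
  proof (rule assms(2)[OF less.prems])
    fix H assume H: "H \<in> L" "G \<subset> H"
    then have "E - H \<subset> E - G" using L_subset by blast
    then have "card (E - H) < card (E - G)" using finite_ground by (simp add: psubset_card_mono)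
    then show "P H" using less.hyps H by blast
  qed
qed

lemma up_split: "G \<in> L \<Longrightarrow> {H \<in> L. G \<subseteq> H} = insert G {H \<in> L. G \<subset> H}"
  by auto

lemma sum_up:
  fixes f :: "'a set \<Rightarrow> 'b::comm_monoid_add"
  shows "G \<in> L \<Longrightarrow> (\<Sum>H\<in>{H \<in> L. G \<subseteq> H}. f H) = f G + (\<Sum>H\<in>{H \<in> L. G \<subset> H}. f H)"
  by (subst up_split) (auto simp: finite_L)

lemma xh_sum: "G \<in> L \<Longrightarrow> (\<Sum>H\<in>{H \<in> L. G \<subseteq> H}. xh H) = hvar G"
  by (simp add: sum_up xh.simps[of G])

text \<open>Induction downwards from \<open>E\<close> takes the place of the Moebius function. In
  the applications \<open>\<psi>\<close> sends \<open>z\<close> to the degree of \<open>z\<close>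
  times fixed factors, so that values on the \<open>xh\<close> are read off from values on the
  \<open>hvar\<close>.\<close>

lemma mobius:
  fixes \<psi> :: "'a hpoly \<Rightarrow> rat"
  assumes "\<And>a b. \<psi> (a + b) = \<psi> a + \<psi> b" and "G \<in> L"
    and "\<And>H. H \<in> L \<Longrightarrow> G \<subseteq> H \<Longrightarrow> \<psi> (hvar H) = (\<Sum>K\<in>{K \<in> L. H \<subseteq> K}. g K)"
  shows "\<psi> (xh G) = g G"
  using assms(2,3)
proof (induction rule: flat_induct)
  case (step G)
  have \<psi>0: "\<psi> 0 = 0" using assms(1)[of 0 0] by simp
  have \<psi>_sum: "\<psi> (\<Sum>i\<in>A. f i) = (\<Sum>i\<in>A. \<psi> (f i))" for A :: "'a set set" and f
    by (induction A rule: infinite_finite_induct) (auto simp: assms(1) \<psi>0)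
  have "\<psi> (xh H) = g H" if "H \<in> {H \<in> L. G \<subset> H}" for H
    by (rule step.IH) (use that step.prems in auto)
  then have "(\<Sum>H\<in>{H \<in> L. G \<subset> H}. \<psi> (xh H)) = (\<Sum>H\<in>{H \<in> L. G \<subset> H}. g H)"
    by (rule sum.cong[OF refl])
  moreover have "\<psi> (hvar G) = \<psi> (xh G) + (\<Sum>H\<in>{H \<in> L. G \<subset> H}. \<psi> (xh H))"
    unfolding xh_sum[OF step.hyps, symmetric] sum_up[OF step.hyps] assms(1) \<psi>_sum ..
  moreover have "\<psi> (hvar G) = g G + (\<Sum>H\<in>{H \<in> L. G \<subset> H}. g H)"
    unfolding sum_up[OF step.hyps, symmetric] by (rule step.prems[OF step.hyps order_refl])
  ultimately show ?case by simp
qed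

lemma mobius_zero:
  fixes \<psi> :: "'a hpoly \<Rightarrow> rat"
  assumes "\<And>a b. \<psi> (a + b) = \<psi> a + \<psi> b" and "G \<in> L"
    and "\<And>H. H \<in> L \<Longrightarrow> G \<subseteq> H \<Longrightarrow> \<psi> (hvar H) = 0"
  shows "\<psi> (xh G) = 0"
  using mobius[OF assms(1,2), of "\<lambda>_. 0"] assms(3) by simp

text \<open>Rado's condition: the members of \<open>m\<close> are contained in \<open>F\<close> and have an independent
  transversal that spans \<open>F\<close>.\<close>

definition full :: "'a set \<Rightarrow> 'a set multiset \<Rightarrow> bool"
  where "full F m \<longleftrightarrow> size m = rk F \<and> (\<forall>G\<in>#m. G \<subseteq> F) \<and> 0 \<le> trk m {}"

text \<open>One member short of \<open>full\<close>. Here \<open>F\<close> has truncated rank 1, so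
  whether a further subset of \<open>F\<close> completes the transversal depends only on whether it
  consists of loops.\<close>

definition prefull :: "'a set \<Rightarrow> 'a set multiset \<Rightarrow> bool"
  where "prefull F m \<longleftrightarrow> Suc (size m) = rk F \<and> (\<forall>G\<in>#m. G \<subseteq> F) \<and> 0 \<le> trk m {}"

lemma trk_nonneg_mono: "0 \<le> trk (m + s) {} \<Longrightarrow> trk m {} = 0"
  using trk_add_le[of m s "{}"] trk_empty_le[of m] by simp

lemma trk_empty_0: "0 \<le> trk m {} \<Longrightarrow> trk m {} = 0"
  using trk_empty_le[of m] by simp

lemma full_add_iff:
  assumes "F \<in> L"
  shows "full F (add_mset H m) \<longleftrightarrow> prefull F m \<and> H \<subseteq> F \<and> \<not> H \<subseteq> loops F m"
proof (cases "prefull F m \<and> H \<subseteq> F")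
  case True
  then have t: "trk m {} = 0" using trk_empty_0 by (auto simp: prefull_def)
  have "H \<subseteq> loops F m \<longleftrightarrow> trk m H \<le> 0"
    using subset_loops_iff[OF t] True assms L_subset by blast
  then show ?thesis using True by (auto simp: full_def prefull_def trk_add)
next
  case False
  then show ?thesis by (auto simp: full_def prefull_def trk_add)
qed

section \<open>Degree maps of the restrictions to flats\<close>

interpretation Deg: linear_extension "\<lambda>a. a" "\<lambda>m. of_bool (full F m) :: rat" for F
  by standard auto

text \<open>The degree map of the ring is \<open>Deg E\<close>; the other flats enter through the
  recursion \<open>Deg_xh_step\<close>, where a factor \<open>xh G\<close> passes to the restriction
  to \<open>G\<close>.\<close>

definition Deg :: "'a set \<Rightarrow> 'a hpoly \<Rightarrow> rat"
  where "Deg F = linear_extension.ext (\<lambda>a. a) (\<lambda>m. of_bool (full F m))"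

lemma Deg_add: "Deg F (p + q) = Deg F p + Deg F q"
  by (simp add: Deg_def Deg.ext_add)
lemma Deg_0 [simp]: "Deg F 0 = 0"
  by (simp add: Deg_def)
lemma Deg_diff: "Deg F (p - q) = Deg F p - Deg F q"
  by (simp add: Deg_def Deg.ext_diff)
lemma Deg_uminus: "Deg F (- p) = - Deg F p"
  by (simp add: Deg_def Deg.ext_uminus)
lemma Deg_sum: "Deg F (\<Sum>i\<in>A. f i) = (\<Sum>i\<in>A. Deg F (f i))"
  by (simp add: Deg_def Deg.ext_sum)
lemma Deg_single: "Deg F (Poly_Mapping.single m a) = a * of_bool (full F m)"
  by (simp add: Deg_def Deg.ext_single)
lemma Deg_hmon: "Deg F (hmon m) = of_bool (full F m)"
  by (simp add: hmon_def Deg_single)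

lemma Deg_scale: "Deg F (Poly_Mapping.single 0 a * p) = a * Deg F p"
proof -
  have "Deg F (Poly_Mapping.single 0 a * p)
      = Deg F (Poly_Mapping.single 0 a * (\<Sum>m\<in>Poly_Mapping.keys p. Poly_Mapping.single m (Poly_Mapping.lookup p m)))"
    using poly_mapping_sum_singles by metis
  also have "\<dots> = a * Deg F (\<Sum>m\<in>Poly_Mapping.keys p. Poly_Mapping.single m (Poly_Mapping.lookup p m))"
    by (simp add: sum_distrib_left mult_single Deg_sum Deg_single mult_ac
        del: sum_mult_of_bool_eq sum_of_bool_mult_eq)
  finally show ?thesis using poly_mapping_sum_singles by metis
qed

lemma Deg_ext_eq:
  assumes "\<And>m. Deg F (p * hmon m) = a * Deg G (q * hmon m)"
  shows "Deg F (p * w) = a * Deg G (q * w)"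
proof -
  have w: "w = (\<Sum>m\<in>Poly_Mapping.keys w. Poly_Mapping.single 0 (Poly_Mapping.lookup w m) * hmon m)"
    using poly_mapping_sum_singles[of w] by (simp add: hmon_def mult_single)
  have *: "Deg F (p * w) = (\<Sum>m\<in>Poly_Mapping.keys w. Poly_Mapping.lookup w m * Deg F (p * hmon m))" for F p
    by (subst w) (simp add: sum_distrib_left Deg_sum mult.left_commute[of p] Deg_scale)
  show ?thesis unfolding * assms by (simp add: sum_distrib_left mult_ac)
qed

lemma Deg_ext_0: "(\<And>m. Deg F (p * hmon m) = 0) \<Longrightarrow> Deg F (p * w) = 0"
  using Deg_ext_eq[of F p 0 F p w] by simp

lemma Deg_hvar_hmon: "Deg F (hvar H * hmon m) = of_bool (full F (add_mset H m))"
proof (cases "rk H = 0")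
  case True
  have "trk (add_mset H m) {} < 0" using trk_le_rk[of m H] True by (simp add: trk_add)
  then show ?thesis using True by (simp add: hvar_def full_def)
next
  case False
  then show ?thesis by (simp add: hvar_def hmon_add[symmetric] Deg_hmon)
qed

text \<open>As the loop set lies in \<open>F\<close>, the condition of \<open>full_add_iff\<close>
  becomes a difference of two indicators of containment in a flat, a form suited to
  \<open>mobius\<close>.\<close>

lemma Deg_hvar_full:
  assumes "F \<in> L"
  shows "Deg F (hvar H * hmon m)
    = (if prefull F m then of_bool (H \<subseteq> F) - of_bool (H \<subseteq> loops F m) else 0)"
proof -
  have "loops F m \<subseteq> F" by (auto simp: loops_def)
  then show ?thesis using full_add_iff[OF assms] by (auto simp: Deg_hvar_hmon)
qed

lemma sum_up_delta:
  "F \<in> L \<Longrightarrow> (\<Sum>K\<in>{K \<in> L. H \<subseteq> K}. of_bool (K = F)) = (of_bool (H \<subseteq> F) :: rat)"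
  by (simp add: of_bool_def finite_L)

text \<open>Containment of \<open>H\<close> in a fixed flat is the sum, over the flats
  \<open>K\<close> above \<open>H\<close>, of the indicator that \<open>K\<close> is this flat.
  Moebius inversion therefore leaves two point masses, at \<open>F\<close> and at the flat
  \<open>loops F m\<close>.\<close>

lemma Deg_xh_hmon:
  assumes "F \<in> L" "G \<in> L"
  shows "Deg F (xh G * hmon m)
    = (if prefull F m then of_bool (G = F) - of_bool (G = loops F m) else 0)"
proof (rule mobius[where \<psi> = "\<lambda>z. Deg F (z * hmon m)", OF _ assms(2)])
  fix H assume H: "H \<in> L" "G \<subseteq> H"
  have "prefull F m \<Longrightarrow> loops F m \<in> L"
    using loops_in_L assms(1) trk_empty_0 by (auto simp: prefull_def)
  then show "Deg F (hvar H * hmon m) = (\<Sum>K\<in>{K \<in> L. H \<subseteq> K}.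
      if prefull F m then of_bool (K = F) - of_bool (K = loops F m) else 0)"
    using assms by (auto simp: Deg_hvar_full sum_subtractf sum_up_delta)
qed (simp add: distrib_right Deg_add)

section \<open>The degree map kills the quadratic relations\<close>

lemma Deg_xh_hvar_cl:
  assumes "F \<in> L" "i \<in> E" "i \<notin> F"
  shows "Deg E (xh F * hvar (cl {i}) * w) = 0"
proof (rule Deg_ext_0)
  fix m
  show "Deg E (xh F * hvar (cl {i}) * hmon m) = 0"
  proof (cases "rk (cl {i}) = 0")
    case True
    then show ?thesis by (simp add: hvar_def)
  next
    case False
    let ?m = "add_mset (cl {i}) m"
    have i: "i \<in> cl {i}" using subset_cl[of "{i}"] assms by auto
    have "rk (cl {i}) \<le> 1" using rk_cl[of "{i}"] rk_insert[of i "{}"] assms by simp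
    \<comment> \<open>Truncation along \<open>cl {i}\<close>, which has rank 1, turns
      \<open>i\<close> into a loop. As \<open>i\<close> is not in \<open>F\<close>, the flat
      \<open>F\<close> is neither \<open>E\<close> nor the loop set.\<close>
    then have "trk ?m {i} \<le> 0"
      using trk_le_rk[of m "cl {i}"] i by (simp add: trk_add insert_absorb min_def)
    then have "i \<in> loops E ?m" using assms by (simp add: loops_def)
    moreover have "xh F * hvar (cl {i}) * hmon m = xh F * hmon ?m"
      using False by (simp add: hvar_def mult.assoc hmon_add[symmetric])
    ultimately show ?thesis using assms Deg_xh_hmon[OF E_in_L assms(1), of ?m] by auto
  qed
qed

text \<open>For \<open>H\<close> of truncated rank 1 the new loop set is the closure of
  \<open>H\<close> in the truncated matroid; the old loops lie in it by submodularity.\<close>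

lemma loops_add_rank1:
  assumes "trk m {} = 0" "H \<subseteq> E" "trk m H = 1"
  shows "loops E (add_mset H m) = {e \<in> E. trk m (insert e H) \<le> 1}"
proof -
  have "trk m {e} \<le> 0 \<Longrightarrow> trk m (insert e H) \<le> 1" for e
    using trk_submodular[of m "{e}" H] trk_mono[of "{}" "{e} \<inter> H" m] assms by (simp del: Int_insert_left)
  then show ?thesis by (auto simp: loops_def trk_add min_def)
qed

text \<open>Two sets of truncated rank 1, one inside the closure of the other, are parallel: their
  union has rank 1, so both have the same closure.\<close>

lemma loops_rank1_eq:
  assumes "trk m {} = 0" "H \<subseteq> E" "trk m H = 1" "H' \<subseteq> E" "trk m H' = 1"
    "H' \<subseteq> loops E (add_mset H m)"
  shows "loops E (add_mset H' m) = loops E (add_mset H m)"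
proof -
  have H: "trk m (H \<union> H') = 1"
  proof -
    have "trk m (H \<union> T) \<le> 1" if "finite T" "T \<subseteq> H'" for T
      using that
    proof (induction T)
      case empty
      then show ?case using assms by simp
    next
      case (insert e T)
      have "trk m (insert e H) \<le> 1"
        using insert assms(6) by (auto simp: loops_add_rank1[OF assms(1-3)])
      moreover have "trk m (insert e H \<union> (H \<union> T)) + trk m (insert e H \<inter> (H \<union> T)) \<le> trk m (insert e H) + trk m (H \<union> T)"
        by (rule trk_submodular)
      moreover have "trk m H \<le> trk m (insert e H \<inter> (H \<union> T))" by (rule trk_mono) auto
      moreover have "insert e H \<union> (H \<union> T) = H \<union> insert e T" by auto
      ultimately show ?case using insert assms by auto
    qed
    then have "trk m (H \<union> H') \<le> 1" using assms(4) finite_ground finite_subset by blast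
    moreover have "trk m H \<le> trk m (H \<union> H')" by (rule trk_mono) auto
    ultimately show ?thesis using assms by simp
  qed
  have *: "trk m (insert e A) \<le> 1" if "trk m (insert e B) \<le> 1" "trk m A = 1" "trk m B = 1" "trk m (B \<union> A) = 1" for e A B
  proof -
    have "trk m (insert e B \<union> (B \<union> A)) + trk m (insert e B \<inter> (B \<union> A)) \<le> trk m (insert e B) + trk m (B \<union> A)"
      by (rule trk_submodular)
    moreover have "trk m B \<le> trk m (insert e B \<inter> (B \<union> A))" by (rule trk_mono) auto
    moreover have "trk m (insert e A) \<le> trk m (insert e B \<union> (B \<union> A))" by (rule trk_mono) auto
    ultimately show ?thesis using that by linarith
  qed
  show ?thesis
    unfolding loops_add_rank1[OF assms(1-3)] loops_add_rank1[OF assms(1,4,5)]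
    using *[of _ H H'] *[of _ H' H] H assms by (auto simp: Un_commute)
qed

lemma not_prefull_add: "rk H = 0 \<Longrightarrow> \<not> prefull F (add_mset H m)"
  using trk_le_rk[of m H] by (auto simp: prefull_def trk_add)

lemma Deg_xh_hvar_hmon:
  assumes "F \<in> L" "G \<in> L"
  shows "Deg F (xh G * hvar H * hmon m) = Deg F (xh G * hmon (add_mset H m))"
proof (cases "rk H = 0")
  case True
  then show ?thesis by (simp add: hvar_def Deg_xh_hmon[OF assms] not_prefull_add)
next
  case False
  then show ?thesis by (simp add: hvar_def mult.assoc hmon_add[symmetric])
qed

text \<open>Every set containing \<open>H\<close> has value at least 2, hence at least 1 after
  lowering by one, so no new loop appears.\<close>

lemma loops_add_rank2:
  assumes "2 \<le> trk m H" shows "loops F (add_mset H m) = loops F m"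
proof -
  have "trk (add_mset H m) {e} \<le> 0 \<longleftrightarrow> trk m {e} \<le> 0" for e
    using assms trk_mono[OF subset_insertI[of H e], of m] by (simp add: trk_add min_le_iff_disj)
  then show ?thesis by (simp add: loops_def)
qed

text \<open>With \<open>F\<close> and \<open>m\<close> fixed, \<open>\<psi> (hvar H)\<close> is -1
  or 0 according to whether \<open>F\<close> is the loop set after truncating along \<open>H\<close>
  as well. Its values for the flats \<open>H\<close> above \<open>G\<close> determine
  \<open>\<psi> (xh G)\<close> by Moebius inversion.\<close>

lemma Deg_xh_xh:
  assumes "F \<in> L" "G \<in> L" "\<not> F \<subseteq> G" "\<not> G \<subseteq> F"
  shows "Deg E (xh F * xh G * w) = 0"
proof (rule Deg_ext_0)
  fix m
  define \<psi> where "\<psi> z = Deg E (xh F * z * hmon m)" for z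
  have add: "\<psi> (a + b) = \<psi> a + \<psi> b" for a b
    by (simp add: \<psi>_def algebra_simps Deg_add)
  have FE: "F \<noteq> E" "G \<noteq> E" using assms L_subset by auto
  have \<psi>: "\<psi> (hvar H) = - of_bool (prefull E (add_mset H m) \<and> F = loops E (add_mset H m))" for H
    unfolding \<psi>_def Deg_xh_hvar_hmon[OF E_in_L assms(1)] Deg_xh_hmon[OF E_in_L assms(1)]
    using FE by auto
  have pre: "trk m {} = 0" "1 \<le> trk m H" if "prefull E (add_mset H m)" for H
    using that trk_empty_le[of m] by (auto simp: prefull_def trk_add)
  have "\<psi> (xh G) = 0"
  proof (cases "F = loops E m \<and> trk m {} = 0 \<and> Suc (Suc (size m)) = rk E \<and> (\<forall>H\<in>#m. H \<subseteq> E)")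
    \<comment> \<open>If \<open>F\<close> is not the loop set of \<open>m\<close>, it can only
      become the loop set as the closure of some \<open>H\<close> of truncated rank 1. Then
      \<open>H\<close>, and with it \<open>G\<close>, would lie in \<open>F\<close>.\<close>
    case False
    show ?thesis
    proof (rule mobius_zero[where \<psi> = \<psi>, OF add assms(2)])
      fix H assume H: "H \<in> L" "G \<subseteq> H"
      have "H \<subseteq> F" if p: "prefull E (add_mset H m)" and l: "F = loops E (add_mset H m)"
      proof -
        have "F \<noteq> loops E m" using False p pre[OF p] by (auto simp: prefull_def)
        then have "trk m H = 1" using l loops_add_rank2[of m H E] pre[OF p] by force
        then have "F = {e \<in> E. trk m (insert e H) \<le> 1}"
          using l loops_add_rank1[OF pre(1)[OF p] L_subset[OF H(1)]] by simp
        then show ?thesis using L_subset[OF H(1)] \<open>trk m H = 1\<close> by (auto simp: insert_absorb)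
      qed
      then show "\<psi> (hvar H) = 0" using H assms(4) by (auto simp: \<psi>)
    qed
  next
    case True
    then have t: "trk m {} = 0" by simp
    \<comment> \<open>\<open>A\<close> consists of the rank-one flats of the matroid truncated along
      \<open>m\<close>. For \<open>H\<close> above \<open>G\<close>, the set \<open>F\<close> stays
      the loop set unless \<open>H\<close> has truncated rank 1, and in that case exactly one member
      of \<open>A\<close> contains \<open>H\<close>.\<close>
    define A where "A = {loops E (add_mset H m) | H. H \<in> L \<and> trk m H = 1}"
    have A_rank: "trk m K \<le> 1" if "K = loops E (add_mset H m)" "H \<in> L" "trk m H = 1" for K H
    proof -
      have "trk (add_mset H m) {} = 0" using t that by (simp add: trk_add)
      then have "trk (add_mset H m) K \<le> 0"
        using subset_loops_iff[of "add_mset H m" K E] that by (auto simp: loops_def)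
      moreover have "H \<subseteq> K" using loops_add_rank1[OF t L_subset[OF that(2)] that(3)] that L_subset
        by (auto simp: insert_absorb)
      ultimately show ?thesis by (auto simp: trk_add Un_absorb2)
    qed
    have "\<psi> (xh G) = - of_bool (G = E) + of_bool (G \<in> A)"
    proof (rule mobius[where \<psi> = \<psi>, OF add assms(2)])
      fix H assume H: "H \<in> L" "G \<subseteq> H"
      have HE: "H \<subseteq> E" by (rule L_subset[OF H(1)])
      have HF: "\<not> H \<subseteq> F" using H assms(4) by auto
      then have H1: "1 \<le> trk m H" using subset_loops_iff[OF t HE order_refl] True by auto
      then have p: "prefull E (add_mset H m)"
        using True HE by (auto simp: prefull_def trk_add)
      have inL: "loops E (add_mset H m) \<in> L"
        by (rule loops_in_L) (use t H1 in \<open>auto simp: trk_add\<close>)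
      have "F = loops E (add_mset H m) \<longleftrightarrow> trk m H \<noteq> 1"
      proof (cases "trk m H = 1")
        case True
        then have "H \<subseteq> loops E (add_mset H m)"
          using loops_add_rank1[OF t HE] HE by (auto simp: insert_absorb)
        then show ?thesis using HF True by auto
      next
        case False
        then show ?thesis using True loops_add_rank2[of m H E] H1 by auto
      qed
      moreover have "(\<Sum>K\<in>{K \<in> L. H \<subseteq> K}. of_bool (K \<in> A)) = (of_bool (trk m H = 1) :: rat)"
      proof -
        have "{K \<in> L. H \<subseteq> K} \<inter> A = (if trk m H = 1 then {loops E (add_mset H m)} else {})"
        proof -
          have "trk m H = 1 \<and> K = loops E (add_mset H m)" if K: "H \<subseteq> K" "K \<in> A" for K
          proof -
            obtain H' where H': "K = loops E (add_mset H' m)" "H' \<in> L" "trk m H' = 1"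
              using K by (auto simp: A_def)
            have "trk m H = 1" using A_rank[OF H'] trk_mono[OF K(1), of m] H1 by simp
            then show ?thesis
              using loops_rank1_eq[OF t L_subset[OF H'(2)] H'(3) HE] K(1) H'(1) by simp
          qed
          moreover have "H \<subseteq> loops E (add_mset H m)" if "trk m H = 1"
            using loops_add_rank1[OF t HE that] HE that by (auto simp: insert_absorb)
          ultimately show ?thesis using inL H(1) by (auto simp: A_def)
        qed
        then have "(\<Sum>K\<in>{K \<in> L. H \<subseteq> K} \<inter> A. 1) = (of_bool (trk m H = 1) :: rat)" by simp
        then show ?thesis
          using sum.inter_restrict[of "{K \<in> L. H \<subseteq> K}" "\<lambda>_. 1::rat" A] finite_L
          by (simp add: of_bool_def)
      qed
      moreover have "(\<Sum>K\<in>{K \<in> L. H \<subseteq> K}. of_bool (K = E)) = (1 :: rat)"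
        using sum_up_delta[OF E_in_L, of H] HE by simp
      ultimately show "\<psi> (hvar H) = (\<Sum>K\<in>{K \<in> L. H \<subseteq> K}. - of_bool (K = E) + of_bool (K \<in> A))"
        using p by (simp add: \<psi> sum.distrib sum_negf sum_subtractf)
    qed
    \<comment> \<open>Loops persist under further truncation, so every member of \<open>A\<close>
      contains \<open>F\<close>, whereas \<open>G\<close> does not.\<close>
    moreover have "G \<notin> A"
    proof
      assume "G \<in> A"
      then obtain H where "G = loops E (add_mset H m)" by (auto simp: A_def)
      then have "F \<subseteq> G" using True trk_add_mset_le[of H m] by (auto simp: loops_def intro: order_trans)
      then show False using assms by simp
    qed
    ultimately show ?thesis using FE by simp
  qed
  then show "Deg E (xh F * xh G * hmon m) = 0" by (simp add: \<psi>_def)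
qed

section \<open>Vanishing of overfull monomials and the recursion of degrees along a chain\<close>

lemma Deg_overfull:
  assumes "\<And>G. G \<in># s \<Longrightarrow> G \<subseteq> F" "rk F < size s"
  shows "Deg F' (hmon s * w) = 0"
proof (rule Deg_ext_0)
  fix m
  have "trk (m + s) {} < 0" by (rule trk_overfull[OF assms])
  then show "Deg F' (hmon s * hmon m) = 0"
    by (simp add: hmon_add[symmetric] Deg_hmon full_def add.commute)
qed

text \<open>If \<open>F\<close> were the loop set, removing \<open>s\<close> would leave it of
  truncated rank 0, and \<open>F'\<close> of truncated rank at most \<open>rk F' - rk F\<close>.
  Truncating along the members of \<open>s\<close> uses this up, so \<open>F'\<close> would consist
  of loops as well.\<close>

lemma Deg_overfull_interval:
  assumes "F \<in> L" "F' \<in> L" "F \<subset> F'" "\<And>G. G \<in># s \<Longrightarrow> G \<subseteq> F' \<and> \<not> G \<subseteq> F"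
    "rk F' \<le> rk F + size s"
  shows "Deg E (xh F * hmon s * w) = 0"
proof (rule Deg_ext_0)
  fix z
  have F': "F' \<subseteq> E" by (rule L_subset[OF assms(2)])
  have "F \<noteq> loops E (z + s)" if p: "prefull E (z + s)"
  proof
    assume F: "F = loops E (z + s)"
    have t: "trk (z + s) {} = 0" using p trk_empty_0 by (auto simp: prefull_def)
    then have "trk z F \<le> 0"
      using trk_loops_strip[OF t order_refl F] assms(4) F' trk_nonneg_mono[of z s] by auto
    then have "trk z F' \<le> int (size s)"
      using trk_quotient[of F F' z] assms by auto
    then have "trk (z + s) F' \<le> 0"
      using trk_add_le_size[of s F' z] assms(4) by auto
    then have "F' \<subseteq> F" using subset_loops_iff[OF t F' order_refl] F by simp
    then show False using assms(3) by auto
  qed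
  moreover have "F \<noteq> E" using assms(3) F' by auto
  ultimately have "Deg E (xh F * hmon (z + s)) = 0"
    using Deg_xh_hmon[OF E_in_L assms(1)] by simp
  then show "Deg E (xh F * hmon s * hmon z) = 0"
    by (simp add: hmon_add mult_ac)
qed

lemma trk_replicate:
  assumes "S \<subseteq> F" shows "trk (z + replicate_mset k F) S = min (trk z S) (trk z F - int k)"
  using assms
proof (induction k arbitrary: S)
  case 0
  then show ?case using trk_mono[of S F z] by simp
next
  case (Suc k)
  have "S \<union> F = F" using Suc by auto
  then show ?case using Suc.IH[OF Suc.prems] Suc.IH[OF order_refl] by (simp add: trk_add)
qed

text \<open>The copies of \<open>F\<close> cut the rank of \<open>F\<close> over \<open>G\<close>
  down to 1. The remaining degree then comes from the point mass at the loop set in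
  \<open>Deg_xh_hmon\<close>, which carries the sign, and \<open>G\<close> is the loop set exactly
  when the other factors are full in \<open>G\<close>.\<close>

lemma Deg_xh_step:
  assumes "F \<in> L" "G \<in> L" "G \<subset> F"
  shows "Deg F (xh G * hmon (replicate_mset (rk F - rk G - 1) F) * w) = - Deg G w"
proof -
  let ?r = "replicate_mset (rk F - rk G - 1) F"
  have rk: "rk G < rk F" using flat_rk_less[OF assms(2,3)] L_subset[OF assms(1)] .
  have FE: "F \<subseteq> E" by (rule L_subset[OF assms(1)])
  have eq: "full G z \<longleftrightarrow> prefull F (z + ?r) \<and> G = loops F (z + ?r)" for z
  proof
    assume z: "full G z"
    then have t: "trk z {} = 0" using trk_empty_0 by (simp add: full_def)
    have zc: "trk z S = int (rk S) - int (rk G)" if "G \<subseteq> S" for S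
      using trk_contained[of z S] z that by (auto simp: full_def)
    have tr: "trk (z + ?r) S = min (trk z S) 1" if "S \<subseteq> F" for S
      using trk_replicate[OF that] zc[of F] assms rk by (simp add: of_nat_diff)
    have p: "prefull F (z + ?r)"
      using z rk assms tr[of "{}"] t by (auto simp: prefull_def full_def)
    moreover have "G = loops F (z + ?r)"
    proof
      have "trk (z + ?r) G \<le> 0" using tr[of G] zc[of G] assms by simp
      moreover have "trk (z + ?r) {} = 0" using tr[of "{}"] t by simp
      ultimately show "G \<subseteq> loops F (z + ?r)"
        using subset_loops_iff[of "z + ?r" G F] FE assms by auto
      show "loops F (z + ?r) \<subseteq> G"
      proof
        fix x assume "x \<in> loops F (z + ?r)"
        then have x: "x \<in> F" "trk z {x} \<le> 0" using tr[of "{x}"] by (auto simp: loops_def)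
        have "trk z ({x} \<union> G) + trk z ({x} \<inter> G) \<le> trk z {x} + trk z G" by (rule trk_submodular)
        moreover have "trk z {} \<le> trk z ({x} \<inter> G)" by (rule trk_mono) auto
        ultimately have "rk (insert x G) \<le> rk G" using x zc[of G] zc[OF subset_insertI[of G x]] t by simp
        then show "x \<in> G" using flat_mem[OF assms(2)] x FE by auto
      qed
    qed
    ultimately show "prefull F (z + ?r) \<and> G = loops F (z + ?r)" by simp
  next
    assume *: "prefull F (z + ?r) \<and> G = loops F (z + ?r)"
    \<comment> \<open>The members not contained in \<open>G\<close>, together with the copies of
      \<open>F\<close>, are stripped off. What remains must have at least \<open>rk G\<close>
      members, which is already the size of \<open>z\<close>, so \<open>zb\<close> is empty.\<close>
    define za zb where "za = filter_mset (\<lambda>H. H \<subseteq> G) z" and "zb = filter_mset (\<lambda>H. \<not> H \<subseteq> G) z"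
    have z: "z = za + zb" unfolding za_def zb_def by (rule multiset_partition)
    have m: "z + ?r = za + (zb + ?r)" using z by simp
    have t: "trk (za + (zb + ?r)) {} = 0" using * trk_empty_0 unfolding m[symmetric] by (simp add: prefull_def)
    have "trk za G \<le> 0"
    proof (rule trk_loops_strip[OF t FE])
      show "G = loops F (za + (zb + ?r))" using * unfolding m[symmetric] by simp
      show "0 \<le> trk za {}" using trk_nonneg_mono[OF eq_refl[OF t[symmetric]]] by simp
      show "H \<subseteq> F \<and> \<not> H \<subseteq> G" if "H \<in># zb + ?r" for H
        using that * assms by (auto simp: prefull_def zb_def split: if_splits)
    qed
    then have "rk G \<le> size za" using trk_contained[of za G] by (auto simp: za_def)
    moreover have sz: "size z = rk G" using * rk by (auto simp: prefull_def)
    ultimately have "zb = {#}" using z by (metis add_le_same_cancel1 le_zero_eq size_eq_0_iff_empty size_union)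
    then have "z = za" using z by simp
    then have "\<And>H. H \<in># z \<Longrightarrow> H \<subseteq> G" by (metis (mono_tags, lifting) za_def mem_Collect_eq set_mset_filter)
    moreover have "trk z {} = 0" using * trk_nonneg_mono[of z ?r] by (auto simp: prefull_def)
    ultimately show "full G z" using sz by (auto simp: full_def)
  qed
  have "Deg F (xh G * hmon ?r * hmon z) = (-1) * Deg G (1 * hmon z)" for z
  proof -
    have "xh G * hmon ?r * hmon z = xh G * hmon (z + ?r)" by (simp add: hmon_add mult_ac)
    then show ?thesis using Deg_xh_hmon[OF assms(1,2), of "z + ?r"] eq[of z] assms(3)
      by (auto simp: Deg_hmon)
  qed
  from Deg_ext_eq[OF this] show ?thesis by simp
qed

end

section \<open>Independence of the Feichtner--Yuzvinsky monomials\<close>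

context matroid
begin

text \<open>The Feichtner--Yuzvinsky monomials, as multisets of flats.\<close>

definition FYm :: "'a set multiset \<Rightarrow> bool"
  where "FYm m \<longleftrightarrow> set_mset m \<subseteq> L \<and> (\<forall>F\<in>#m. \<forall>G\<in>#m. F \<subseteq> G \<or> G \<subseteq> F)
    \<and> (\<forall>F\<in>#m. count m F \<le> rk F) \<and> (\<forall>F\<in>#m. \<forall>G\<in>#m. F \<subset> G \<longrightarrow> rk F + count m G < rk G)"

text \<open>The list is a chain of flats \<open>F \<supset> G\<^sub>1 \<supset> G\<^sub>2 \<supset> \<dots>\<close>, and \<open>top_exp\<close> is the largest exponent that
  the Feichtner--Yuzvinsky conditions allow on it.  A monomial dividing it is tested against
  the complementary monomial times the product of the \<open>xh G\<^sub>i\<close>.\<close>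

fun desc :: "'a set \<Rightarrow> 'a set list \<Rightarrow> bool"
  where
    "desc F [] \<longleftrightarrow> F \<in> L"
  | "desc F (G # cs) \<longleftrightarrow> F \<in> L \<and> G \<subset> F \<and> desc G cs"

fun top_exp :: "'a set \<Rightarrow> 'a set list \<Rightarrow> 'a set multiset"
  where
    "top_exp F [] = replicate_mset (rk F) F"
  | "top_exp F (G # cs) = replicate_mset (rk F - rk G - 1) F + top_exp G cs"

definition xprod :: "'a set list \<Rightarrow> 'a hpoly" where "xprod cs = prod_list (map xh cs)"

section \<open>Counting conditions on monomials along a chain\<close>

definition below :: "'a set multiset \<Rightarrow> 'a set \<Rightarrow> nat"
  where "below n F = size (filter_mset (\<lambda>G. G \<subseteq> F) n)"

text \<open>The key that breaks ties in the size: the pairing is triangular for it, and the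
  rewriting in the spanning argument increases it.\<close>

definition rksum :: "'a set multiset \<Rightarrow> nat" where "rksum m = (\<Sum>G\<in>#m. rk G)"

lemma desc_L: "desc F cs \<Longrightarrow> F \<in> L"
  by (cases cs) auto

lemma desc_subset: "desc F cs \<Longrightarrow> G \<in> set cs \<Longrightarrow> G \<subset> F"
  by (induction F cs rule: desc.induct) auto

lemma desc_rk_less: "desc F (G # cs) \<Longrightarrow> rk G < rk F"
  using flat_rk_less L_subset desc_L by (metis desc.simps(2))

lemma xprod_Nil [simp]: "xprod [] = 1"
  and xprod_Cons [simp]: "xprod (G # cs) = xh G * xprod cs"
  by (simp_all add: xprod_def)

lemma rksum_simps [simp]: "rksum {#} = 0" "rksum (add_mset G m) = rk G + rksum m"
  "rksum (m + n) = rksum m + rksum n" "rksum (replicate_mset k G) = k * rk G"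
  by (simp_all add: rksum_def)

lemma below_add: "below (m + n) F = below m F + below n F"
  by (simp add: below_def)

lemma below_all: "(\<And>G. G \<in># n \<Longrightarrow> G \<subseteq> F) \<Longrightarrow> below n F = size n"
  by (simp add: below_def filter_mset_eq_conv flip: filter_mset_True)
    (metis (mono_tags, lifting) filter_mset_True filter_mset_cong0)

lemma size_top_exp: "desc F cs \<Longrightarrow> size (top_exp F cs) + length cs = rk F"
proof (induction F cs rule: desc.induct)
  case (2 F G cs)
  then show ?case using desc_rk_less[of F G cs] by auto
qed simp

lemma top_exp_subset: "desc F cs \<Longrightarrow> G \<in># top_exp F cs \<Longrightarrow> G \<subseteq> F"
proof (induction F cs rule: desc.induct)
  case (2 F H cs)
  then show ?case by (auto split: if_splits)
qed (auto split: if_splits)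

text \<open>Each \<open>xh\<close> on the chain contributes -1 through \<open>Deg_xh_step\<close>;
  at the last flat \<open>F\<close> the power of exponent \<open>rk F\<close> has degree 1.\<close>

lemma Deg_top_exp: "desc F cs \<Longrightarrow> Deg F (xprod cs * hmon (top_exp F cs)) = (- 1) ^ length cs"
proof (induction F cs rule: desc.induct)
  case (1 F)
  have "trk (replicate_mset (rk F) F) {} = 0"
    using trk_replicate[of "{}" F "{#}" "rk F"] by simp
  then have "full F (replicate_mset (rk F) F)" by (auto simp: full_def split: if_splits)
  then show ?case by (simp add: Deg_hmon)
next
  case (2 F G cs)
  have "Deg F (xprod (G # cs) * hmon (top_exp F (G # cs)))
    = Deg F (xh G * hmon (replicate_mset (rk F - rk G - 1) F) * (xprod cs * hmon (top_exp G cs)))"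
    by (simp add: hmon_add mult_ac)
  also have "\<dots> = - Deg G (xprod cs * hmon (top_exp G cs))"
    by (rule Deg_xh_step) (use 2 desc_L in auto)
  finally show ?case using 2 by simp
qed

text \<open>Necessary for a nonzero degree: at most \<open>rk F - rk G - 1\<close> members of
  \<open>n\<close> lie in \<open>F\<close> but not in the next flat \<open>G\<close>, and the last
  flat contains at most as many members as its rank. Terms are moved across to avoid
  subtraction.\<close>

fun bounded :: "'a set \<Rightarrow> 'a set list \<Rightarrow> 'a set multiset \<Rightarrow> bool"
  where
    "bounded F [] n \<longleftrightarrow> below n F \<le> rk F"
  | "bounded F (G # cs) n \<longleftrightarrow> below n F + rk G < rk F + below n G \<and> bounded G cs n"

text \<open>Too many members in the last flat are excluded by \<open>Deg_overfull\<close>, too many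
  between consecutive flats by \<open>Deg_overfull_interval\<close>. The arbitrary \<open>w\<close>
  absorbs the factors \<open>xh\<close> of the larger flats during the induction.\<close>

lemma bounded_if_Deg: "desc F cs \<Longrightarrow> Deg E (xprod cs * hmon n * w) \<noteq> 0 \<Longrightarrow> bounded F cs n"
proof (induction F cs arbitrary: w rule: desc.induct)
  case (1 F)
  show ?case
  proof (rule ccontr)
    define s where "s = filter_mset (\<lambda>G. G \<subseteq> F) n"
    assume "\<not> bounded F [] n"
    then have "Deg E (hmon s * (hmon (filter_mset (\<lambda>G. \<not> G \<subseteq> F) n) * w)) = 0"
      by (intro Deg_overfull[of _ F]) (auto simp: s_def below_def)
    then have "Deg E (hmon n * w) = 0"
      by (simp add: s_def mult.assoc[symmetric] hmon_add[symmetric] multiset_partition[symmetric])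
    then show False using 1 by simp
  qed
next
  case (2 F G cs)
  define s where "s = filter_mset (\<lambda>H. H \<subseteq> F \<and> \<not> H \<subseteq> G) n"
  define s' where "s' = filter_mset (\<lambda>H. \<not> (H \<subseteq> F \<and> \<not> H \<subseteq> G)) n"
  have n: "n = s + s'" unfolding s_def s'_def by (rule multiset_partition)
  have GF: "G \<subset> F" using 2 by simp
  have "below n F = below n G + size s"
  proof -
    let ?A = "filter_mset (\<lambda>H. H \<subseteq> F) n"
    have "?A = filter_mset (\<lambda>H. H \<subseteq> G) ?A + filter_mset (\<lambda>H. \<not> H \<subseteq> G) ?A"
      by (rule multiset_partition)
    moreover have "filter_mset (\<lambda>H. H \<subseteq> G) ?A = filter_mset (\<lambda>H. H \<subseteq> G) n"
      unfolding filter_filter_mset by (rule filter_mset_cong) (use GF in auto)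
    moreover have "filter_mset (\<lambda>H. \<not> H \<subseteq> G) ?A = s"
      unfolding filter_filter_mset s_def by (rule filter_mset_cong) auto
    ultimately show ?thesis by (metis below_def size_union)
  qed
  moreover have "rk G + size s < rk F"
  proof (rule ccontr)
    assume "\<not> ?thesis"
    then have "Deg E (xh G * hmon s * (xprod cs * hmon s' * w)) = 0"
      by (intro Deg_overfull_interval[where F' = F]) (use 2 desc_L in \<open>auto simp: s_def\<close>)
    then show False using 2(3) by (simp add: n hmon_add mult_ac)
  qed
  moreover have "bounded G cs n"
    by (rule 2(1)[of "xh G * w"]) (use 2 in \<open>auto simp: mult_ac\<close>)
  ultimately show ?case by simp
qed

lemma bounded_upper: "bounded F cs n \<Longrightarrow> below n F + length cs \<le> rk F"
  by (induction F cs rule: top_exp.induct) auto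

text \<open>When the total attains the bound of \<open>bounded_upper\<close>, all inequalities in
  \<open>bounded\<close> are tight, so the counts are determined by the chain alone.\<close>

lemma bounded_eq:
  assumes "bounded F cs n" "below n F + length cs = rk F" "G \<in> set cs"
    and "bounded F cs n'" "below n' F + length cs = rk F"
  shows "below n G = below n' G"
  using assms
proof (induction F cs rule: top_exp.induct)
  case (2 F H cs)
  have "below n H + length cs = rk H" "below n' H + length cs = rk H"
    using bounded_upper[of H cs n] bounded_upper[of H cs n'] 2 by auto
  then show ?case using 2 by auto
qed simp

lemma rksum_top:
  assumes "set_mset q \<subseteq> L" "\<And>G. G \<in># q \<Longrightarrow> G \<subseteq> F" "F \<in> L"
  shows "rksum q \<le> size q * rk F \<and> (rksum q = size q * rk F \<longrightarrow> q = replicate_mset (size q) F)"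
  using assms(1,2)
proof (induction q)
  case (add G q)
  have "rk G \<le> rk F" using add by (intro rk_mono) auto
  moreover have "rk G = rk F \<Longrightarrow> G = F" using add assms(3) by (intro flat_eqI) auto
  moreover have "rksum q \<le> size q * rk F \<and> (rksum q = size q * rk F \<longrightarrow> q = replicate_mset (size q) F)"
    using add by auto
  ultimately show ?case by auto
qed simp

lemma eq_replicate_mset: "(\<And>G. G \<in># p \<Longrightarrow> G = F) \<Longrightarrow> p = replicate_mset (size p) F"
  by (induction p) auto

text \<open>The counts fix how many members lie between consecutive flats of the chain. Within such
  an interval the rank is largest only at its top flat, and \<open>p\<close> has all its members in
  this extremal position.\<close>

lemma rksum_le_of_below_eq:
  assumes "desc F cs" "set_mset p \<subseteq> insert F (set cs)" "set_mset q \<subseteq> L"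
    "\<And>G. G \<in># q \<Longrightarrow> G \<subseteq> F" "size q = size p" "\<And>G. G \<in> set cs \<Longrightarrow> below q G = below p G"
  shows "rksum q \<le> rksum p \<and> (rksum q = rksum p \<longrightarrow> q = p)"
  using assms
proof (induction F cs arbitrary: p q rule: desc.induct)
  case (1 F)
  have "p = replicate_mset (size p) F" by (rule eq_replicate_mset) (use 1 in auto)
  then show ?case using rksum_top[of q F] 1 by (metis desc.simps(1) rksum_simps(4))
next
  case (2 F G cs)
  have GF: "G \<subset> F" using 2 by simp
  define p1 p2 where "p1 = filter_mset (\<lambda>H. H \<subseteq> G) p" and "p2 = filter_mset (\<lambda>H. \<not> H \<subseteq> G) p"
  define q1 q2 where "q1 = filter_mset (\<lambda>H. H \<subseteq> G) q" and "q2 = filter_mset (\<lambda>H. \<not> H \<subseteq> G) q"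
  have p: "p = p1 + p2" unfolding p1_def p2_def by (rule multiset_partition)
  have q: "q = q1 + q2" unfolding q1_def q2_def by (rule multiset_partition)
  have s1: "size q1 = size p1" using 2(7)[of G] by (simp add: below_def p1_def q1_def)
  have s2: "size q2 = size p2" using s1 2(6) by (simp add: p q)
  have below1: "below (filter_mset (\<lambda>H. H \<subseteq> G) m) K = below m K" if "K \<subseteq> G" for m K
    unfolding below_def filter_filter_mset by (rule arg_cong[where f = size], rule filter_mset_cong) (use that in auto)
  have "rksum q1 \<le> rksum p1 \<and> (rksum q1 = rksum p1 \<longrightarrow> q1 = p1)"
  proof (rule 2(1))
    show "desc G cs" using 2 by simp
    show "set_mset p1 \<subseteq> insert G (set cs)" using 2(3) GF by (auto simp: p1_def)
    show "set_mset q1 \<subseteq> L" using 2(4) by (auto simp: q1_def)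
    show "below q1 K = below p1 K" if "K \<in> set cs" for K
    proof -
      have "K \<subseteq> G" using desc_subset[of G cs K] 2 that by auto
      then show ?thesis using 2(7)[of K] that by (simp add: p1_def q1_def below1)
    qed
  qed (use s1 in \<open>auto simp: q1_def\<close>)
  moreover have "p2 = replicate_mset (size p2) F"
  proof (rule eq_replicate_mset)
    fix H assume "H \<in># p2"
    then have "H \<in># p" "\<not> H \<subseteq> G" by (auto simp: p2_def)
    then show "H = F" using 2(2,3) desc_subset[of G cs H] by auto
  qed
  moreover have "rksum q2 \<le> size q2 * rk F \<and> (rksum q2 = size q2 * rk F \<longrightarrow> q2 = replicate_mset (size q2) F)"
    by (rule rksum_top) (use 2 in \<open>auto simp: q2_def\<close>)
  moreover from calculation(2) have "rksum p2 = size p2 * rk F" by (metis rksum_simps(4))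
  ultimately have "rksum q1 \<le> rksum p1 \<and> (rksum q1 = rksum p1 \<longrightarrow> q1 = p1)"
    "rksum q2 \<le> rksum p2 \<and> (rksum q2 = rksum p2 \<longrightarrow> q2 = p2)"
    using s2 by auto
  then show ?case by (auto simp: p q)
qed

lemma chain_desc:
  assumes "finite C" "C \<subseteq> L" "\<And>F G. F \<in> C \<Longrightarrow> G \<in> C \<Longrightarrow> F \<subseteq> G \<or> G \<subseteq> F"
    "\<And>G. G \<in> C \<Longrightarrow> G \<subset> F" "F \<in> L"
  shows "\<exists>cs. desc F cs \<and> set cs = C"
  using assms
proof (induction "card C" arbitrary: C F rule: less_induct)
  case less
  show ?case
  proof (cases "C = {}")
    case True
    then show ?thesis using less.prems by (intro exI[of _ "[]"]) auto
  next
    case False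
    then obtain M where M: "M \<in> C" "\<And>G. G \<in> C \<Longrightarrow> M \<subseteq> G \<Longrightarrow> G = M"
      using finite_has_maximal[OF less.prems(1)] by metis
    then have max: "G \<subseteq> M" if "G \<in> C" for G using less.prems(3)[OF M(1) that] that by auto
    have "card (C - {M}) < card C" using less.prems(1) M(1) by (rule card_Diff1_less)
    then have "\<exists>cs. desc M cs \<and> set cs = C - {M}"
    proof (rule less.hyps)
      show "G \<subset> M" if "G \<in> C - {M}" for G using max that by auto
    qed (use less.prems M in auto)
    then obtain cs where "desc M cs" "set cs = C - {M}" by blast
    then show ?thesis using M less.prems by (intro exI[of _ "M # cs"]) auto
  qed
qed

text \<open>Since every flat of \<open>cs\<close> occurs in \<open>p\<close>, the conditions on
  pairs of members include the consecutive ones that define \<open>top_exp\<close>. The first flat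
  \<open>F\<close> may have multiplicity 0, which allows starting at \<open>E\<close>.\<close>

lemma subset_top_exp:
  assumes "desc F cs" "set_mset p \<subseteq> insert F (set cs)" "set cs \<subseteq> set_mset p"
    "\<And>H. H \<in># p \<Longrightarrow> count p H \<le> rk H"
    "\<And>G H. G \<in># p \<Longrightarrow> H \<in># p \<Longrightarrow> G \<subset> H \<Longrightarrow> rk G + count p H < rk H"
  shows "p \<subseteq># top_exp F cs"
  using assms
proof (induction F cs arbitrary: p rule: desc.induct)
  case (1 F)
  have "p = replicate_mset (size p) F" by (rule eq_replicate_mset) (use 1 in auto)
  moreover from this have "size p \<le> rk F"
    by (metis 1(4) count_replicate_mset in_replicate_mset bot_nat_0.extremum not_gr0)
  ultimately show ?case by (metis top_exp.simps(1) replicate_mset_msubseteq_iff)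
next
  case (2 F G cs)
  define p' where "p' = filter_mset (\<lambda>H. H \<noteq> F) p"
  have F: "F \<notin> insert G (set cs)" using desc_subset[of F "G # cs"] 2(2) by fastforce
  have p: "p = replicate_mset (count p F) F + p'"
    unfolding p'_def using multiset_partition[of p "\<lambda>H. H = F"] by (simp add: filter_eq_replicate_mset)
  have mem: "H \<in># p' \<longleftrightarrow> H \<in># p \<and> H \<noteq> F" for H by (simp add: p'_def)
  have cnt: "count p' H = count p H" if "H \<in># p'" for H using that by (simp add: p'_def)
  have "p' \<subseteq># top_exp G cs"
  proof (rule 2(1))
    show "desc G cs" using 2 by simp
    show "set_mset p' \<subseteq> insert G (set cs)" using 2(3) mem by auto
    show "set cs \<subseteq> set_mset p'" using 2(4) F mem by auto
  qed (use 2(5,6) mem cnt in auto)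
  moreover have "count p F \<le> rk F - rk G - 1"
  proof (cases "F \<in># p")
    case True
    then show ?thesis using 2(2,4) 2(6)[of G F] by simp
  next
    case False
    then show ?thesis by (simp add: not_in_iff)
  qed
  ultimately have "replicate_mset (count p F) F + p' \<subseteq># top_exp F (G # cs)"
    unfolding top_exp.simps by (intro subset_mset.add_mono) (simp_all add: replicate_mset_msubseteq_iff)
  then show ?case using p by simp
qed

text \<open>The witness \<open>t\<close> complements \<open>p\<close> to the top exponent on its
  chain. A nonzero degree of \<open>hmon q * t\<close> imposes \<open>bounded\<close> on
  \<open>q + (e - p)\<close>; this bounds the size of \<open>q\<close>, and at equal size it fixes
  the counts of \<open>q\<close> on the chain.\<close>

lemma FYm_test:
  assumes "FYm p"
  obtains t where "Deg E (hmon p * t) \<noteq> 0"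
    and "\<And>q. set_mset q \<subseteq> L \<Longrightarrow> Deg E (hmon q * t) \<noteq> 0 \<Longrightarrow>
      size q \<le> size p \<and> (size q = size p \<longrightarrow> rksum q \<le> rksum p \<and> (rksum q = rksum p \<longrightarrow> q = p))"
proof -
  have pL: "set_mset p \<subseteq> L" using assms by (simp add: FYm_def)
  have "\<exists>cs. desc E cs \<and> set cs = set_mset p - {E}"
    by (rule chain_desc) (use assms L_subset in \<open>auto simp: FYm_def\<close>)
  then obtain cs where cs: "desc E cs" "set cs = set_mset p - {E}" by blast
  define e where "e = top_exp E cs"
  have "p \<subseteq># e" unfolding e_def
    by (rule subset_top_exp[OF cs(1)]) (use cs(2) assms in \<open>auto simp: FYm_def\<close>)
  then have e: "e = p + (e - p)" by simp
  define t where "t = xprod cs * hmon (e - p)"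
  have shift: "hmon q * t = xprod cs * hmon (q + (e - p)) * 1" for q
    by (simp add: t_def hmon_add mult_ac)
  have De: "Deg E (xprod cs * hmon e * 1) \<noteq> 0"
    using Deg_top_exp[OF cs(1)] by (simp add: e_def)
  have eE: "G \<in># e \<Longrightarrow> G \<subseteq> E" for G unfolding e_def by (rule top_exp_subset[OF cs(1)])
  have se: "size e + length cs = rk E" unfolding e_def by (rule size_top_exp[OF cs(1)])
  show ?thesis
  proof
    show "Deg E (hmon p * t) \<noteq> 0" unfolding shift using De e by simp
  next
    fix q assume q: "set_mset q \<subseteq> L" "Deg E (hmon q * t) \<noteq> 0"
    let ?n = "q + (e - p)"
    have b: "bounded E cs ?n"
      by (rule bounded_if_Deg[OF cs(1)]) (use q(2) in \<open>simp only: shift\<close>)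
    have be: "bounded E cs e" by (rule bounded_if_Deg[OF cs(1) De])
    have nE: "G \<subseteq> E" if "G \<in># ?n" for G using that q(1) eE L_subset by (auto dest: in_diffD)
    have sn: "below ?n E = size ?n" by (rule below_all) (rule nE)
    have "size e = size p + size (e - p)" using e by (metis size_union)
    then have *: "size ?n + length cs = rk E" if "size q = size p" using se that by simp
    have "size q \<le> size p"
      using bounded_upper[OF b] sn se \<open>size e = _\<close> by simp
    moreover have "rksum q \<le> rksum p \<and> (rksum q = rksum p \<longrightarrow> q = p)" if sq: "size q = size p"
    proof (rule rksum_le_of_below_eq[OF cs(1)])
      show "below q G = below p G" if "G \<in> set cs" for G
      proof -
        have "below ?n G = below e G"
          by (rule bounded_eq[OF b _ that be]) (use *[OF sq] sn se below_all[of e E] eE in auto)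
        moreover have "below e G = below p G + below (e - p) G" using e by (metis below_add)
        ultimately show ?thesis by (simp add: below_add)
      qed
    qed (use cs(2) q L_subset sq in auto)
    ultimately show "size q \<le> size p \<and> (size q = size p \<longrightarrow> rksum q \<le> rksum p \<and> (rksum q = rksum p \<longrightarrow> q = p))"
      by blast
  qed
qed

lemma Deg_hvar: "Deg F (hvar G * w) = Deg F (hmon {#G#} * w)"
proof (cases "rk G = 0")
  case True
  have "Deg F (hmon {#G#} * hmon m) = 0" for m
    using Deg_hvar_hmon[of F G m] True by (simp add: hvar_def hmon_add[symmetric] Deg_hmon)
  then have "Deg F (hmon {#G#} * w) = 0" by (rule Deg_ext_0)
  then show ?thesis using True by (simp add: hvar_def)
qed (simp add: hvar_def)

definition xhm :: "'a set multiset \<Rightarrow> 'a hpoly" where "xhm m = (\<Prod>G\<in>#m. xh G)"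

lemma xhm_simps [simp]: "xhm {#} = 1" "xhm (add_mset G m) = xh G * xhm m"
  by (simp_all add: xhm_def)

text \<open>Expanding each \<open>xh G\<close> as \<open>hvar G\<close> minus the
  \<open>xh H\<close> of larger flats gives the leading monomial and monomials of the same size with
  larger rank sum, which pair to 0 with \<open>t\<close>. The factors already expanded are collected
  in \<open>n0\<close>.\<close>

lemma Deg_xhm_eq_hmon:
  assumes "set_mset q \<subseteq> L" "set_mset n0 \<subseteq> L"
    and "\<And>n. set_mset n \<subseteq> L \<Longrightarrow> size n = size n0 + size q \<Longrightarrow> rksum n0 + rksum q < rksum n \<Longrightarrow> Deg E (hmon n * t) = 0"
  shows "Deg E (hmon n0 * xhm q * t) = Deg E (hmon (n0 + q) * t)"
  using assms
proof (induction q arbitrary: n0)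
  case (add G q)
  have "G \<in> L" using add.prems by simp
  then show ?case using add.prems
  proof (induction rule: flat_induct)
    case (step G)
    have H: "Deg E (hmon n0 * xh H * xhm q * t) = 0" if "H \<in> {H \<in> L. G \<subset> H}" for H
    proof -
      have rk: "rk G < rk H" using that L_subset flat_rk_less[of G H] step.hyps by auto
      have "Deg E (hmon n0 * xhm (add_mset H q) * t) = Deg E (hmon (n0 + add_mset H q) * t)"
        by (rule step.IH) (use that step.prems rk in \<open>auto intro!: step.prems(3)\<close>)
      also have "\<dots> = 0" by (rule step.prems(3)) (use that step.prems rk in auto)
      finally show ?thesis by (simp add: mult_ac)
    qed
    have "Deg E (hmon n0 * xhm (add_mset G q) * t)
        = Deg E (hmon n0 * hvar G * xhm q * t) - (\<Sum>H\<in>{H \<in> L. G \<subset> H}. Deg E (hmon n0 * xh H * xhm q * t))"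
      by (simp add: xh.simps[of G] algebra_simps Deg_diff sum_distrib_left sum_distrib_right Deg_sum)
    also have "(\<Sum>H\<in>{H \<in> L. G \<subset> H}. Deg E (hmon n0 * xh H * xhm q * t)) = 0"
      by (intro sum.neutral ballI H)
    also have "Deg E (hmon n0 * hvar G * xhm q * t) - 0 = Deg E (hvar G * (hmon n0 * xhm q * t))"
      by (simp add: mult_ac)
    also have "\<dots> = Deg E (hmon (add_mset G n0) * xhm q * t)"
      using hmon_add[of "{#G#}" n0] Deg_hvar[of E G "hmon n0 * xhm q * t"] by (simp add: mult_ac)
    also have "\<dots> = Deg E (hmon (add_mset G n0 + q) * t)"
      by (rule add.IH) (use step.prems in auto)
    finally show ?case by simp
  qed
qed simp

lemma FYm_independent:
  assumes "finite S" "\<And>m. m \<in> S \<Longrightarrow> FYm m"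
    and "\<And>w. Deg E ((\<Sum>m\<in>S. Poly_Mapping.single 0 (c m) * xhm m) * w) = 0"
    and "p0 \<in> S"
  shows "c p0 = 0"
proof (rule ccontr)
  assume "c p0 \<noteq> 0"
  \<comment> \<open>A monomial with nonzero coefficient is chosen least by size, then by rank sum.
    Its test element annihilates all larger monomials and all other ones with the same size and rank
    sum.\<close>
  define R where "R = inv_image (less_than <*lex*> less_than) (\<lambda>m. (size m, rksum m))"
  have "wf R" by (auto simp: R_def)
  then obtain p where p: "p \<in> S" "c p \<noteq> 0" and min: "\<And>q. (q, p) \<in> R \<Longrightarrow> \<not> (q \<in> S \<and> c q \<noteq> 0)"
    using wfE_min[of R p0 "{m \<in> S. c m \<noteq> 0}"] assms(4) \<open>c p0 \<noteq> 0\<close> by auto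
  obtain t where t: "Deg E (hmon p * t) \<noteq> 0"
    "\<And>q. set_mset q \<subseteq> L \<Longrightarrow> Deg E (hmon q * t) \<noteq> 0 \<Longrightarrow>
      size q \<le> size p \<and> (size q = size p \<longrightarrow> rksum q \<le> rksum p \<and> (rksum q = rksum p \<longrightarrow> q = p))"
    using FYm_test[OF assms(2)[OF p(1)]] by metis
  have tri: "Deg E (xhm q * t) = Deg E (hmon q * t)"
    if "set_mset q \<subseteq> L" "(q, p) \<notin> R" for q
  proof -
    have "Deg E (hmon {#} * xhm q * t) = Deg E (hmon ({#} + q) * t)"
    proof (rule Deg_xhm_eq_hmon)
      fix n assume n: "set_mset n \<subseteq> L" "size n = size {#} + size q" "rksum {#} + rksum q < rksum n"
      show "Deg E (hmon n * t) = 0"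
        using t(2)[OF n(1)] n(2,3) that(2) by (fastforce simp: R_def)
    qed (use that in auto)
    then show ?thesis by simp
  qed
  have zero: "c q * Deg E (xhm q * t) = 0" if "q \<in> S - {p}" for q
  proof (cases "c q = 0")
    case False
    have qL: "set_mset q \<subseteq> L" using assms(2)[of q] that by (auto simp: FYm_def)
    have nR: "(q, p) \<notin> R" using min[of q] that False by auto
    then have "Deg E (hmon q * t) = 0"
      using t(2)[OF qL] that by (fastforce simp: R_def)
    then show ?thesis using tri[OF qL nR] by simp
  qed simp
  have "0 = Deg E ((\<Sum>m\<in>S. Poly_Mapping.single 0 (c m) * xhm m) * t)" using assms(3) by simp
  also have "\<dots> = (\<Sum>m\<in>S. c m * Deg E (xhm m * t))"
    by (simp add: sum_distrib_right Deg_sum mult.assoc Deg_scale)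
  also have "\<dots> = c p * Deg E (xhm p * t)"
    using sum.remove[OF assms(1) p(1), of "\<lambda>m. c m * Deg E (xhm m * t)"] zero by simp
  also have "Deg E (xhm p * t) = Deg E (hmon p * t)"
    by (rule tri) (use assms(2)[OF p(1)] in \<open>auto simp: FYm_def R_def\<close>)
  finally show False using p(2) t(1) by simp
qed

end

section \<open>Relations in the augmented Chow ring\<close>

definition var_monomial :: "('v \<Rightarrow> 'r::comm_ring_1) \<Rightarrow> ('v \<Rightarrow>\<^sub>0 nat) \<Rightarrow> 'r"
  where "var_monomial f m = (\<Prod>v\<in>Poly_Mapping.keys m. f v ^ Poly_Mapping.lookup m v)"

lemma var_monomial_superset:
  assumes "finite S" "Poly_Mapping.keys m \<subseteq> S"
  shows "var_monomial f m = (\<Prod>v\<in>S. f v ^ Poly_Mapping.lookup m v)"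
  unfolding var_monomial_def
  by (rule prod.mono_neutral_left) (use assms in \<open>auto simp: in_keys_iff\<close>)

lemma var_monomial_add: "var_monomial f (m + n) = var_monomial f m * var_monomial f n"
proof -
  let ?S = "Poly_Mapping.keys m \<union> Poly_Mapping.keys n"
  have "Poly_Mapping.keys (m + n) \<subseteq> ?S" by (rule keys_add)
  then show ?thesis
    by (simp add: var_monomial_superset[of ?S] lookup_add power_add prod.distrib)
qed

lemma var_monomial_0 [simp]: "var_monomial f 0 = 1"
  by (simp add: var_monomial_def)

lemma var_monomial_single: "var_monomial f (Poly_Mapping.single v (Suc 0)) = f v"
  by (simp add: var_monomial_def)

definition peval :: "('v \<Rightarrow> 'k::comm_monoid_add \<Rightarrow>\<^sub>0 rat) \<Rightarrow> 'v mpoly_rat \<Rightarrow> 'k \<Rightarrow>\<^sub>0 rat"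
  where "peval f = linear_extension.ext (Poly_Mapping.single 0) (var_monomial f)"

interpretation peval: multiplicative_extension "Poly_Mapping.single (0::'k::comm_monoid_add)" "var_monomial f" for f
  by standard (simp_all add: single_add mult_single var_monomial_add)

lemma peval_hom:
  shows peval_add: "peval f (p + q) = peval f p + peval f q"
    and peval_mult: "peval f (p * q) = peval f p * peval f q"
    and peval_diff: "peval f (p - q) = peval f p - peval f q"
    and peval_uminus: "peval f (- p) = - peval f p"
    and peval_0: "peval f 0 = 0"
    and peval_sum: "peval f (\<Sum>i\<in>A. g i) = (\<Sum>i\<in>A. peval f (g i))"
    and peval_mvar: "peval f (mvar v) = f v"
    and peval_mconst: "peval f (mconst c) = Poly_Mapping.single 0 c"
  by (simp_all add: peval_def peval.ext_add peval.ext_mult peval.ext_diff peval.ext_uminus peval.ext_sum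
      mvar_def mconst_def peval.ext_single var_monomial_single)

lemma peval_1: "peval f 1 = 1"
  using peval_mconst[of f 1] by (simp add: mconst_def)

abbreviation mpolys :: "'v set \<Rightarrow> 'v mpoly_rat set"
  where "mpolys V \<equiv> carrier (mpoly_ring V)"

lemma mpoly_ring_simps [simp]:
  "monoid.mult (mpoly_ring V) = (*)" "monoid.one (mpoly_ring V) = 1" "ring.zero (mpoly_ring V) = 0" "ring.add (mpoly_ring V) = (+)"
  by (auto simp: mpoly_ring_def)

lemma mpolys_iff: "p \<in> mpolys V \<longleftrightarrow> (\<forall>m\<in>Poly_Mapping.keys p. Poly_Mapping.keys m \<subseteq> V)"
  by (simp add: mpoly_ring_def)

lemma keys_uminus: "Poly_Mapping.keys (- (p :: 'k \<Rightarrow>\<^sub>0 rat)) = Poly_Mapping.keys p"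
  by (auto simp: in_keys_iff)

lemma mpolys_add: "p \<in> mpolys V \<Longrightarrow> q \<in> mpolys V \<Longrightarrow> p + q \<in> mpolys V"
  using keys_add[of p q] unfolding mpolys_iff by blast

lemma mpolys_uminus: "p \<in> mpolys V \<Longrightarrow> - p \<in> mpolys V"
  unfolding mpolys_iff keys_uminus .

lemma mpolys_diff: "p \<in> mpolys V \<Longrightarrow> q \<in> mpolys V \<Longrightarrow> p - q \<in> mpolys V"
  using mpolys_add[of p V "- q"] mpolys_uminus[of q V] by simp

lemma mpolys_mult: "p \<in> mpolys V \<Longrightarrow> q \<in> mpolys V \<Longrightarrow> p * q \<in> mpolys V"
  using keys_mult[of p q] unfolding mpolys_iff by (fastforce dest: subsetD[OF keys_add])

lemma mpolys_single: "Poly_Mapping.keys m \<subseteq> V \<Longrightarrow> Poly_Mapping.single m c \<in> mpolys V"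
  unfolding mpolys_iff by (auto simp: keys_single split: if_splits)

lemma mpolys_mvar: "v \<in> V \<Longrightarrow> mvar v \<in> mpolys V"
  unfolding mvar_def by (rule mpolys_single) simp

lemma mpolys_mconst: "mconst c \<in> mpolys V"
  unfolding mconst_def by (rule mpolys_single) simp

lemma mpolys_0: "0 \<in> mpolys V"
  by (simp add: mpolys_iff)

lemma mpolys_1: "1 \<in> mpolys V"
  using mpolys_mconst[of 1 V] by (simp add: mconst_def)

lemma mpolys_sum: "(\<And>i. i \<in> A \<Longrightarrow> f i \<in> mpolys V) \<Longrightarrow> (\<Sum>i\<in>A. f i) \<in> mpolys V"
  by (induction A rule: infinite_finite_induct) (auto simp: mpolys_0 mpolys_add)

lemma mpolys_power: "p \<in> mpolys V \<Longrightarrow> p ^ k \<in> mpolys V"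
  by (induction k) (auto simp: mpolys_1 mpolys_mult)

lemma mpoly_cring: "cring (mpoly_ring V)"
proof (rule cringI)
  show "abelian_group (mpoly_ring V)"
  proof (rule abelian_groupI)
    fix p assume "p \<in> mpolys V"
    then show "\<exists>q\<in>mpolys V. q \<oplus>\<^bsub>mpoly_ring V\<^esub> p = \<zero>\<^bsub>mpoly_ring V\<^esub>"
      by (intro bexI[of _ "- p"]) (auto simp: mpolys_uminus)
  qed (auto simp: mpolys_add mpolys_0 add_ac)
  show "comm_monoid (mpoly_ring V)"
    by (rule comm_monoidI) (auto simp: mpolys_mult mpolys_1 mult_ac)
qed (auto simp: algebra_simps)

lemma mpoly_ring_minus:
  assumes "p \<in> mpolys V" "q \<in> mpolys V"
  shows "p \<ominus>\<^bsub>mpoly_ring V\<^esub> q = p - q"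
proof -
  interpret cring "mpoly_ring V" by (rule mpoly_cring)
  have "\<ominus>\<^bsub>mpoly_ring V\<^esub> q = - q"
    by (rule minus_equality) (use assms mpolys_uminus in auto)
  then show ?thesis by (simp add: a_minus_def)
qed

text \<open>Tailored to the spanning argument, which processes one variable factor at a time.
  Monomials are built by induction on the total degree.\<close>

lemma mpoly_induct [consumes 1, case_names const var add]:
  assumes "p \<in> mpolys V"
    and const: "\<And>c. P (mconst c)"
    and var: "\<And>p v. p \<in> mpolys V \<Longrightarrow> P p \<Longrightarrow> v \<in> V \<Longrightarrow> P (p * mvar v)"
    and add: "\<And>p q. p \<in> mpolys V \<Longrightarrow> q \<in> mpolys V \<Longrightarrow> P p \<Longrightarrow> P q \<Longrightarrow> P (p + q)"
  shows "P p"
proof -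
  have mono: "P (Poly_Mapping.single m c)" if "Poly_Mapping.keys m \<subseteq> V" for m c
    using that
  proof (induction "\<Sum>v\<in>Poly_Mapping.keys m. Poly_Mapping.lookup m v" arbitrary: m rule: less_induct)
    case less
    show ?case
    proof (cases "m = 0")
      case True
      then show ?thesis using const by (simp add: mconst_def)
    next
      case False
      then obtain v where v: "v \<in> Poly_Mapping.keys m"
        by (metis ex_in_conv in_keys_iff lookup_zero poly_mapping_eqI)
      define m' where "m' = m - Poly_Mapping.single v 1"
      have l: "0 < Poly_Mapping.lookup m v" using v by (simp add: in_keys_iff)
      have m: "m = m' + Poly_Mapping.single v 1"
        by (rule poly_mapping_eqI) (use l in \<open>auto simp: m'_def lookup_add lookup_minus lookup_single when_def\<close>)
      have sub: "Poly_Mapping.keys m' \<subseteq> Poly_Mapping.keys m"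
        by (auto simp: m'_def in_keys_iff lookup_minus lookup_single when_def)
      have "(\<Sum>v\<in>Poly_Mapping.keys m'. Poly_Mapping.lookup m' v) \<le> (\<Sum>v\<in>Poly_Mapping.keys m. Poly_Mapping.lookup m' v)"
        by (rule sum_mono2) (use sub in auto)
      also have "\<dots> < (\<Sum>v\<in>Poly_Mapping.keys m. Poly_Mapping.lookup m v)"
        by (rule sum_strict_mono_ex1)
          (use v l in \<open>auto simp: m'_def lookup_minus lookup_single when_def intro!: bexI[of _ v]\<close>)
      finally have P: "P (Poly_Mapping.single m' c)" by (rule less.hyps) (use sub less.prems in auto)
      have "Poly_Mapping.single m c = Poly_Mapping.single m' c * mvar v"
        by (simp add: mvar_def mult_single m)
      then show ?thesis using var[OF mpolys_single P] sub v less.prems by auto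
    qed
  qed
  have "P (\<Sum>m\<in>K. Poly_Mapping.single m (Poly_Mapping.lookup p m))" if "finite K" "K \<subseteq> Poly_Mapping.keys p" for K
    using that
  proof (induction K)
    case empty
    then show ?case using const[of 0] by (simp add: mconst_def)
  next
    case (insert m K)
    have 1: "Poly_Mapping.keys m' \<subseteq> V" if "m' \<in> insert m K" for m'
      using that insert.prems assms(1) unfolding mpolys_iff by blast
    then show ?case
      using insert by (simp add: add mono mpolys_single mpolys_sum)
  qed
  from this[OF finite_keys order_refl] show ?thesis
    using poly_mapping_sum_singles[of p] by simp
qed

context matroid
begin

section \<open>The defining ideal and its image under the degree map\<close>

abbreviation AP :: "'a aug_var mpoly_rat ring" where "AP \<equiv> aug_poly_ring E indep"
abbreviation AC :: "'a aug_var mpoly_rat set" where "AC \<equiv> mpolys (aug_vars E indep)"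
abbreviation AI :: "'a aug_var mpoly_rat set" where "AI \<equiv> aug_ideal E indep"

text \<open>Representatives of \<open>aug_x\<close>, so that the computations take place in the
  polynomial ring modulo \<open>AI\<close> and pass to the quotient only at the end.\<close>

definition xpoly :: "'a set \<Rightarrow> 'a aug_var mpoly_rat"
  where "xpoly F = (if F = E then - (\<Sum>G\<in>L - {E}. mvar (XVar G)) else mvar (XVar F))"

lemma mvar_XVar_in_AC: "F \<in> L - {E} \<Longrightarrow> mvar (XVar F) \<in> AC"
  by (rule mpolys_mvar) (auto simp: aug_vars_def)

lemma mvar_YVar_in_AC: "i \<in> E \<Longrightarrow> mvar (YVar i) \<in> AC"
  by (rule mpolys_mvar) (auto simp: aug_vars_def)

lemma xpoly_in_AC: "F \<in> L \<Longrightarrow> xpoly F \<in> AC"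
proof (cases "F = E")
  case True
  have "(\<Sum>G\<in>L - {E}. mvar (XVar G)) \<in> AC" by (rule mpolys_sum) (rule mvar_XVar_in_AC)
  then show ?thesis using True by (simp add: xpoly_def mpolys_uminus)
next
  case False
  moreover assume "F \<in> L"
  ultimately show ?thesis using mvar_XVar_in_AC[of F] by (simp add: xpoly_def)
qed

lemma xpoly_sum_0: "(\<Sum>F\<in>L. xpoly F) = 0"
proof -
  have "(\<Sum>F\<in>L. xpoly F) = xpoly E + (\<Sum>F\<in>L - {E}. xpoly F)"
    by (rule sum.remove) (auto simp: finite_L)
  also have "(\<Sum>F\<in>L - {E}. xpoly F) = (\<Sum>F\<in>L - {E}. mvar (XVar F))"
    by (rule sum.cong) (auto simp: xpoly_def)
  finally show ?thesis by (simp add: xpoly_def)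
qed

definition gens1 where "gens1 = {mvar (XVar F) * mvar (XVar G) |F G.
       F \<in> L - {E} \<and> G \<in> L - {E} \<and> \<not> F \<subseteq> G \<and> \<not> G \<subseteq> F}"
definition gens2 where "gens2 = {mvar (YVar i) * mvar (XVar F) |i F. i \<in> E \<and> F \<in> L - {E} \<and> i \<notin> F}"
definition gens3 where "gens3 =
    {mvar (YVar i) - (\<Sum>F\<in>{F \<in> L - {E}. i \<notin> F}. mvar (XVar F)) |i. i \<in> E}"

lemma aug_ideals_gens:
  "aug_ideal1 E indep = genideal AP gens1" "aug_ideal2 E indep = genideal AP gens2"
  "aug_ideal3 E indep = genideal AP gens3"
  by (simp_all add: aug_ideal1_def aug_ideal2_def aug_ideal3_def gens1_def gens2_def gens3_def)

lemma AP_cring: "cring AP"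
  by (simp add: aug_poly_ring_def mpoly_cring)

sublocale AP: cring AP
  by (rule AP_cring)

lemma AP_simps [simp]:
  "carrier AP = AC" "monoid.mult AP = (*)" "monoid.one AP = 1" "ring.zero AP = 0" "ring.add AP = (+)"
  by (simp_all add: aug_poly_ring_def)

lemma gens_in_AC: "gens1 \<subseteq> AC" "gens2 \<subseteq> AC" "gens3 \<subseteq> AC"
  unfolding gens1_def gens2_def gens3_def
  by (auto intro!: mpolys_mult mpolys_diff mpolys_sum mvar_XVar_in_AC mvar_YVar_in_AC)

lemma ideal_genideal: "S \<subseteq> AC \<Longrightarrow> ideal (genideal AP S) AP"
  using AP.genideal_ideal[of S] by simp

lemma AI_ideal: "ideal AI AP"
  unfolding aug_ideal_def aug_ideals_gens
  by (intro AP.add_ideals ideal_genideal gens_in_AC)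

sublocale AI: ideal AI AP
  by (rule AI_ideal)

lemma AI_0: "0 \<in> AI"
  using AI.zero_closed by simp

lemma AI_add: "p \<in> AI \<Longrightarrow> q \<in> AI \<Longrightarrow> p + q \<in> AI"
  using AI.a_closed by simp

lemma AI_mult: "p \<in> AI \<Longrightarrow> q \<in> AC \<Longrightarrow> q * p \<in> AI"
  using AI.I_l_closed by simp

lemma AI_uminus: "p \<in> AI \<Longrightarrow> - p \<in> AI"
  using AI_mult[OF _ mpolys_uminus[OF mpolys_1], of p] by simp

lemma AI_diff: "p \<in> AI \<Longrightarrow> q \<in> AI \<Longrightarrow> p - q \<in> AI"
  using AI_add[of p "- q"] AI_uminus[of q] by simp

lemma AI_sum: "(\<And>i. i \<in> A \<Longrightarrow> f i \<in> AI) \<Longrightarrow> (\<Sum>i\<in>A. f i) \<in> AI"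
  by (induction A rule: infinite_finite_induct) (auto simp: AI_0 AI_add)

lemma genideal_0: "S \<subseteq> AC \<Longrightarrow> 0 \<in> genideal AP S"
  using additive_subgroup.zero_closed[OF ideal.axioms(1)[OF ideal_genideal]] by fastforce

lemma AI_iff:
  "p \<in> AI \<longleftrightarrow> (\<exists>a\<in>genideal AP gens1. \<exists>b\<in>genideal AP gens2. \<exists>c\<in>genideal AP gens3. p = a + b + c)"
  by (auto simp: aug_ideal_def aug_ideals_gens set_add_def')

lemma gens_in_AI: "gens1 \<subseteq> AI" "gens2 \<subseteq> AI" "gens3 \<subseteq> AI"
proof -
  have mem: "a + b + c \<in> AI" if "a \<in> genideal AP gens1" "b \<in> genideal AP gens2" "c \<in> genideal AP gens3" for a b c
    using that unfolding AI_iff by blast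
  have sub: "p \<in> genideal AP S" if "S \<subseteq> AC" "p \<in> S" for S p using AP.genideal_self[of S] that by auto
  note gen = sub[OF gens_in_AC(1)] sub[OF gens_in_AC(2)] sub[OF gens_in_AC(3)]
  note zero = gens_in_AC[THEN genideal_0]
  show "gens1 \<subseteq> AI"
  proof
    fix p assume "p \<in> gens1"
    from mem[OF gen(1)[OF this] zero(2,3)] show "p \<in> AI" by simp
  qed
  show "gens2 \<subseteq> AI"
  proof
    fix p assume "p \<in> gens2"
    from mem[OF zero(1) gen(2)[OF this] zero(3)] show "p \<in> AI" by simp
  qed
  show "gens3 \<subseteq> AI"
  proof
    fix p assume "p \<in> gens3"
    from mem[OF zero(1,2) gen(3)[OF this]] show "p \<in> AI" by simp
  qed
qed

text \<open>The image of y_i is chosen such that the generators in \<open>gens3\<close> are sent to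
  0.\<close>

fun var_image :: "'a aug_var \<Rightarrow> 'a hpoly"
  where
    "var_image (XVar F) = xh F"
  | "var_image (YVar i) = (\<Sum>F\<in>{F \<in> L - {E}. i \<notin> F}. xh F)"

abbreviation to_h :: "'a aug_var mpoly_rat \<Rightarrow> 'a hpoly" where "to_h \<equiv> peval var_image"

lemma cl_empty: "cl {} \<in> L" "rk (cl {}) = 0" "F \<in> L \<Longrightarrow> cl {} \<subseteq> F"
  using cl_in_L[of "{}"] rk_cl[of "{}"] cl_subset_flat[of "{}" F] by auto

lemma xh_sum_0: "(\<Sum>F\<in>L. xh F) = 0"
proof -
  have "{F \<in> L. cl {} \<subseteq> F} = L" using cl_empty by auto
  then show ?thesis using xh_sum[OF cl_empty(1)] cl_empty(2) by (simp add: hvar_def)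
qed

lemma to_h_xpoly: "F \<in> L \<Longrightarrow> to_h (xpoly F) = xh F"
proof (cases "F = E")
  case True
  have "(\<Sum>F\<in>L. xh F) = xh E + (\<Sum>F\<in>L - {E}. xh F)"
    by (rule sum.remove) (auto simp: finite_L)
  then show ?thesis using True xh_sum_0
    by (simp add: xpoly_def peval_uminus peval_sum peval_mvar eq_neg_iff_add_eq_0 neg_eq_iff_add_eq_0 add.commute)
qed (simp add: xpoly_def peval_mvar)

text \<open>The flats containing \<open>i\<close> are those above \<open>cl {i}\<close>, and all
  \<open>xh F\<close> sum to 0. This reduces the generators in \<open>gens2\<close> to
  \<open>Deg_xh_hvar_cl\<close>.\<close>

lemma var_image_YVar: "i \<in> E \<Longrightarrow> var_image (YVar i) = - hvar (cl {i})"
proof -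
  assume i: "i \<in> E"
  have "{F \<in> L. cl {i} \<subseteq> F} = L - {F \<in> L - {E}. i \<notin> F}"
    using cl_subset_flat_iff[of "{i}"] i by auto
  then have "hvar (cl {i}) = (\<Sum>F\<in>L - {F \<in> L - {E}. i \<notin> F}. xh F)"
    using xh_sum[OF cl_in_L[of "{i}"]] i by simp
  also have "\<dots> = (\<Sum>F\<in>L. xh F) - var_image (YVar i)"
    by (simp add: finite_L sum_diff)
  finally show ?thesis by (simp add: xh_sum_0)
qed

lemma Deg_to_h_AI:
  assumes "p \<in> AI" shows "Deg E (to_h p * w) = 0"
proof -
  \<comment> \<open>Quantifying over all \<open>w\<close> makes \<open>K\<close> an ideal, so only
    the generators have to be checked.\<close>
  define K where "K = {p \<in> AC. \<forall>w. Deg E (to_h p * w) = 0}"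
  have K: "ideal K AP"
  proof (rule idealI)
    show "ring AP" by (rule AP.ring_axioms)
    show "subgroup K (add_monoid AP)"
    proof (rule AP.add.subgroupI)
      show "K \<subseteq> carrier AP" by (auto simp: K_def)
      show "K \<noteq> {}" using mpolys_0 by (auto simp: K_def peval_0 intro!: exI[of _ 0])
    next
      fix p assume p: "p \<in> K"
      then have "\<ominus>\<^bsub>AP\<^esub> p = - p"
        by (intro AP.minus_equality) (auto simp: K_def mpolys_uminus)
      then show "\<ominus>\<^bsub>AP\<^esub> p \<in> K"
        using p by (auto simp: K_def mpolys_uminus peval_uminus Deg_uminus)
    qed (auto simp: K_def mpolys_add peval_add distrib_right Deg_add)
    show "q \<otimes>\<^bsub>AP\<^esub> p \<in> K" "p \<otimes>\<^bsub>AP\<^esub> q \<in> K" if "p \<in> K" "q \<in> carrier AP" for p q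
      using that by (auto simp: K_def mpolys_mult peval_mult mult.assoc mult.left_commute[of "to_h q"])
  qed
  have "gens1 \<subseteq> K" "gens2 \<subseteq> K" "gens3 \<subseteq> K"
  proof -
    have "Deg E (to_h p * w) = 0" if p: "p \<in> gens1" for p w
    proof -
      obtain F G where "p = mvar (XVar F) * mvar (XVar G)" "F \<in> L" "G \<in> L" "\<not> F \<subseteq> G" "\<not> G \<subseteq> F"
        using p unfolding gens1_def by blast
      then show ?thesis using Deg_xh_xh by (simp add: peval_mult peval_mvar)
    qed
    then show "gens1 \<subseteq> K" using gens_in_AC by (auto simp: K_def)
    have "Deg E (to_h p * w) = 0" if p: "p \<in> gens2" for p w
    proof -
      obtain i F where iF: "p = mvar (YVar i) * mvar (XVar F)" "i \<in> E" "F \<in> L" "i \<notin> F"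
        using p unfolding gens2_def by blast
      then have "to_h p * w = - (xh F * hvar (cl {i}) * w)"
        using var_image_YVar by (simp add: peval_mult peval_mvar mult_ac del: var_image.simps(2))
      then show ?thesis using Deg_xh_hvar_cl iF by (simp add: Deg_uminus)
    qed
    then show "gens2 \<subseteq> K" using gens_in_AC by (auto simp: K_def)
    have "to_h p = 0" if "p \<in> gens3" for p
      using that by (auto simp: gens3_def peval_diff peval_sum peval_mvar)
    then show "gens3 \<subseteq> K" using gens_in_AC by (auto simp: K_def)
  qed
  then have sub: "genideal AP gens1 \<subseteq> K" "genideal AP gens2 \<subseteq> K" "genideal AP gens3 \<subseteq> K"
    using AP.genideal_minimal[OF K] by auto
  obtain a b c where "p = a + b + c" "a \<in> K" "b \<in> K" "c \<in> K"
    using assms sub unfolding AI_iff by blast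
  then have "p \<in> K" by (auto simp: K_def mpolys_add peval_add distrib_right Deg_add)
  then show ?thesis by (simp add: K_def)
qed

definition xmono :: "'a set multiset \<Rightarrow> 'a aug_var mpoly_rat" where "xmono m = (\<Prod>F\<in>#m. xpoly F)"

lemma xmono_simps [simp]: "xmono {#} = 1" "xmono (add_mset G m) = xpoly G * xmono m"
  "xmono (m + n) = xmono m * xmono n" "xmono (replicate_mset k G) = xpoly G ^ k"
  by (simp_all add: xmono_def)

lemma xmono_in_AC: "set_mset m \<subseteq> L \<Longrightarrow> xmono m \<in> AC"
  by (induction m) (auto simp: mpolys_1 mpolys_mult xpoly_in_AC)

lemma to_h_xmono: "set_mset m \<subseteq> L \<Longrightarrow> to_h (xmono m) = xhm m"
  by (induction m) (auto simp: peval_1 peval_mult to_h_xpoly)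

lemma xmono_independent:
  assumes "finite S" "\<And>m. m \<in> S \<Longrightarrow> FYm m"
    and "(\<Sum>m\<in>S. mconst (c m) * xmono m) \<in> AI" and "p \<in> S"
  shows "c p = 0"
proof (rule FYm_independent[OF assms(1,2) _ assms(4)])
  fix w
  have "to_h (\<Sum>m\<in>S. mconst (c m) * xmono m) = (\<Sum>m\<in>S. Poly_Mapping.single 0 (c m) * xhm m)"
    unfolding peval_sum
    by (rule sum.cong) (use assms(2) in \<open>auto simp: peval_mult peval_mconst to_h_xmono FYm_def\<close>)
  then show "Deg E ((\<Sum>m\<in>S. Poly_Mapping.single 0 (c m) * xhm m) * w) = 0"
    using Deg_to_h_AI[OF assms(3)] by simp
qed

section \<open>Powers of h_G modulo the ideal\<close>

definition hp :: "'a set \<Rightarrow> 'a aug_var mpoly_rat"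
  where "hp G = (\<Sum>H\<in>{H \<in> L. G \<subseteq> H}. xpoly H)"

lemma hp_in_AC: "hp G \<in> AC"
  unfolding hp_def by (rule mpolys_sum) (auto intro: xpoly_in_AC)

lemma hp_cl_empty: "hp (cl {}) = 0"
proof -
  have "{F \<in> L. cl {} \<subseteq> F} = L" using cl_empty by auto
  then show ?thesis using xpoly_sum_0 by (simp add: hp_def)
qed

lemma xpoly_mult_incomparable:
  assumes "F \<in> L" "G \<in> L" "\<not> F \<subseteq> G" "\<not> G \<subseteq> F"
  shows "xpoly F * xpoly G \<in> AI"
proof -
  have "F \<noteq> E" "G \<noteq> E" using assms L_subset by auto
  then have "xpoly F * xpoly G \<in> gens1" using assms by (auto simp: gens1_def xpoly_def)
  then show ?thesis using gens_in_AI by auto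
qed

lemma hp_diff:
  assumes "G \<subseteq> G'"
  shows "hp G - hp G' = (\<Sum>H\<in>{H \<in> L. G \<subseteq> H \<and> \<not> G' \<subseteq> H}. xpoly H)"
proof -
  have "hp G = (\<Sum>H\<in>{H \<in> L. G' \<subseteq> H} \<union> {H \<in> L. G \<subseteq> H \<and> \<not> G' \<subseteq> H}. xpoly H)"
    unfolding hp_def by (rule sum.cong) (use assms in auto)
  also have "\<dots> = hp G' + (\<Sum>H\<in>{H \<in> L. G \<subseteq> H \<and> \<not> G' \<subseteq> H}. xpoly H)"
    unfolding hp_def by (rule sum.union_disjoint) (auto simp: finite_L)
  finally show ?thesis by simp
qed

text \<open>Modulo the ideal, \<open>hp (cl {i})\<close> is the negative of y_i because all
  \<open>xpoly F\<close> sum to 0, and y_i annihilates x_F.\<close>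

lemma xpoly_hp_cl_single:
  assumes "F \<in> L" "i \<in> E" "i \<notin> F"
  shows "xpoly F * hp (cl {i}) \<in> AI"
proof -
  let ?s = "\<Sum>F\<in>{F \<in> L - {E}. i \<notin> F}. mvar (XVar F)"
  have FE: "F \<noteq> E" using assms by auto
  have "{H \<in> L. cl {i} \<subseteq> H} = L - {F \<in> L - {E}. i \<notin> F}"
    using cl_subset_flat_iff[of "{i}"] assms by auto
  then have "hp (cl {i}) = (\<Sum>F\<in>L. xpoly F) - (\<Sum>F\<in>{F \<in> L - {E}. i \<notin> F}. xpoly F)"
    by (simp add: hp_def finite_L sum_diff)
  also have "(\<Sum>F\<in>{F \<in> L - {E}. i \<notin> F}. xpoly F) = ?s"
    by (rule sum.cong) (auto simp: xpoly_def)
  finally have h: "hp (cl {i}) = - ?s" by (simp add: xpoly_sum_0)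
  have "mvar (YVar i) - ?s \<in> AI" using gens_in_AI(3) assms by (auto simp: gens3_def)
  moreover have "mvar (YVar i) * xpoly F \<in> AI"
    using gens_in_AI(2) assms FE by (auto simp: gens2_def xpoly_def)
  ultimately have "xpoly F * (mvar (YVar i) - ?s) - mvar (YVar i) * xpoly F \<in> AI"
    using AI_diff[OF AI_mult[OF _ xpoly_in_AC[OF assms(1)]]] by blast
  then show ?thesis by (simp add: h algebra_simps)
qed

text \<open>The flats that occur in \<open>hp (cl {i})\<close> but not in \<open>hp G\<close> are
  incomparable to \<open>H\<close>: they contain \<open>i\<close>, and one above \<open>H\<close>
  would contain \<open>cl (insert i H)\<close> and hence \<open>G\<close>. So \<open>hp G\<close>
  may be replaced by \<open>hp (cl {i})\<close>.\<close>

lemma xpoly_hp: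
  assumes "H \<in> L" "i \<in> E" "i \<notin> H" "G \<in> L" "i \<in> G" "G \<subseteq> cl (insert i H)"
  shows "xpoly H * hp G \<in> AI"
proof -
  have iG: "cl {i} \<subseteq> G" using cl_subset_flat[of "{i}" G] assms by auto
  have "xpoly H * xpoly K \<in> AI" if K: "K \<in> L" "cl {i} \<subseteq> K" "\<not> G \<subseteq> K" for K
  proof (rule xpoly_mult_incomparable[OF assms(1) K(1)])
    have iK: "i \<in> K" using K(2) subset_cl[of "{i}"] assms by auto
    then show "\<not> K \<subseteq> H" using assms by auto
    show "\<not> H \<subseteq> K" using cl_subset_flat[of "insert i H" K] K iK assms by auto
  qed
  then have "xpoly H * (hp (cl {i}) - hp G) \<in> AI"
    unfolding hp_diff[OF iG] sum_distrib_left by (intro AI_sum) auto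
  then have "xpoly H * hp (cl {i}) - xpoly H * (hp (cl {i}) - hp G) \<in> AI"
    by (intro AI_diff xpoly_hp_cl_single assms)
  then show ?thesis by (simp add: algebra_simps)
qed

text \<open>The difference is the sum of the \<open>xpoly H\<close> with \<open>H\<close> above
  \<open>G'\<close> but not above the cover of \<open>G'\<close>; \<open>xpoly_hp\<close>
  annihilates each of them.\<close>

lemma hp_square:
  assumes "G' \<in> L" "i \<in> E" "i \<notin> G'"
  shows "hp (cl (insert i G')) * (hp G' - hp (cl (insert i G'))) \<in> AI"
proof -
  let ?G = "cl (insert i G')"
  have sub: "insert i G' \<subseteq> E" using assms L_subset by auto
  have G: "?G \<in> L" "insert i G' \<subseteq> ?G" using cl_in_L[OF sub] subset_cl[OF sub] by auto
  have "xpoly H * hp ?G \<in> AI" if H: "H \<in> L" "G' \<subseteq> H" "\<not> ?G \<subseteq> H" for H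
  proof (rule xpoly_hp[OF H(1) assms(2) _ G(1)])
    show "i \<notin> H" using cl_subset_flat[of "insert i G'" H] H by auto
    show "i \<in> ?G" using G by auto
    have sH: "insert i H \<subseteq> E" using assms H L_subset by auto
    show "?G \<subseteq> cl (insert i H)"
      by (rule cl_subset_flat[OF _ cl_in_L[OF sH]]) (use subset_cl[OF sH] H in auto)
  qed
  moreover have "G' \<subseteq> ?G" using G by auto
  ultimately have "(\<Sum>H\<in>{H \<in> L. G' \<subseteq> H \<and> \<not> ?G \<subseteq> H}. hp ?G * xpoly H) \<in> AI"
    by (intro AI_sum) (auto simp: mult.commute)
  then show ?thesis by (simp add: hp_diff[OF \<open>G' \<subseteq> ?G\<close>] sum_distrib_left)
qed

text \<open>By \<open>hp_square\<close>, once a factor h of the cover is present, every h of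
  \<open>G'\<close> can be exchanged for another one. The extra factor raises the exponent by
  one.\<close>

lemma hp_power_step:
  assumes "G' \<in> L" "i \<in> E" "i \<notin> G'" "z \<in> AC" "z * hp G' ^ s \<in> AI"
  shows "z * hp (cl (insert i G')) ^ Suc s \<in> AI"
proof -
  let ?G = "cl (insert i G')"
  have "hp ?G * hp G' ^ s - hp ?G ^ Suc s \<in> AI"
  proof (induction s)
    case 0
    then show ?case by (simp add: AI_0)
  next
    case (Suc s)
    have "hp ?G * hp G' ^ Suc s - hp ?G ^ Suc (Suc s)
      = hp ?G * (hp ?G * hp G' ^ s - hp ?G ^ Suc s) + hp G' ^ s * (hp ?G * (hp G' - hp ?G))"
      by (simp add: algebra_simps)
    then show ?case
      using AI_add[OF AI_mult[OF Suc hp_in_AC] AI_mult[OF hp_square[OF assms(1-3)] mpolys_power[OF hp_in_AC]]]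
      by simp
  qed
  then have "hp ?G * (z * hp G' ^ s) - z * (hp ?G * hp G' ^ s - hp ?G ^ Suc s) \<in> AI"
    by (rule AI_diff[OF AI_mult[OF assms(5) hp_in_AC] AI_mult[OF _ assms(4)]])
  then show ?thesis by (simp add: algebra_simps)
qed

lemma hp_power:
  assumes "F \<in> L" "G \<in> L" "F \<subseteq> G" "z \<in> AC" "z * hp F ^ k \<in> AI"
  shows "z * hp G ^ (k + (rk G - rk F)) \<in> AI"
  using assms
proof (induction "rk G - rk F" arbitrary: F k)
  case 0
  then have "F = G" using rk_mono[of F G] flat_eqI[of F G] by simp
  then show ?case using 0 by simp
next
  case (Suc d)
  then obtain i where i: "i \<in> G" "i \<notin> F" by (metis diff_self_eq_0 nat.distinct(1) subsetI subset_antisym)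
  have iE: "i \<in> E" using i L_subset[OF Suc.prems(2)] by auto
  let ?F = "cl (insert i F)"
  have sub: "insert i F \<subseteq> E" using iE L_subset[OF Suc.prems(1)] by auto
  have rk: "rk ?F = Suc (rk F)" using rk_cl_insert Suc.prems(1) iE i by blast
  have "z * hp ?F ^ Suc k \<in> AI"
    by (rule hp_power_step) (use Suc.prems iE i in auto)
  moreover have "?F \<subseteq> G" by (rule cl_subset_flat) (use Suc.prems i in auto)
  ultimately have "z * hp G ^ (Suc k + (rk G - rk ?F)) \<in> AI"
    by (intro Suc.hyps(1)) (use Suc.prems Suc.hyps(2) rk cl_in_L[OF sub] in auto)
  moreover have "Suc k + (rk G - rk ?F) = k + (rk G - rk F)" using rk Suc.hyps(2) by simp
  ultimately show ?case by metis
qed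

text \<open>The climb by \<open>hp_power\<close> starts at rank 0 with
  \<open>hp (cl {}) = 0\<close>, so the final exponent is the rank plus one.\<close>

lemma hp_power_top: "G \<in> L \<Longrightarrow> hp G ^ Suc (rk G) \<in> AI"
  using hp_power[OF cl_empty(1) _ cl_empty(3), of G 1 1] cl_empty(2)
  by (simp add: hp_cl_empty AI_0 mpolys_1)

text \<open>The climb starts one rank above \<open>F\<close>, where \<open>xpoly F\<close> already
  annihilates the first power; this gives the exponent \<open>1 + (rk G - rk F - 1)\<close>.\<close>

lemma xpoly_hp_power:
  assumes "F \<in> L" "G \<in> L" "F \<subset> G"
  shows "xpoly F * hp G ^ (rk G - rk F) \<in> AI"
proof -
  obtain i where i: "i \<in> G" "i \<notin> F" using assms by blast
  have iE: "i \<in> E" using i L_subset[OF assms(2)] by auto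
  let ?F = "cl (insert i F)"
  have sub: "insert i F \<subseteq> E" using iE L_subset[OF assms(1)] by auto
  have rk: "rk ?F = Suc (rk F)" using rk_cl_insert assms(1) iE i by blast
  have "xpoly F * hp ?F ^ 1 \<in> AI"
    using xpoly_hp[OF assms(1) iE i(2) cl_in_L[OF sub]] subset_cl[OF sub] by simp
  moreover have "?F \<subseteq> G" by (rule cl_subset_flat) (use assms i in auto)
  ultimately have "xpoly F * hp G ^ (1 + (rk G - rk ?F)) \<in> AI"
    by (intro hp_power) (use assms cl_in_L[OF sub] xpoly_in_AC in auto)
  moreover have "1 + (rk G - rk ?F) = rk G - rk F"
    using rk flat_rk_less[OF assms(1,3) L_subset[OF assms(2)]] by simp
  ultimately show ?thesis by metis
qed

end

section \<open>Spanning and the basis\<close>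

context matroid
begin

definition spanned :: "'a aug_var mpoly_rat set"
  where "spanned = {p. \<exists>c. p - (\<Sum>m\<in>Collect FYm. mconst (c m) * xmono m) \<in> AI}"

text \<open>The exponent bounds limit the size. Finiteness gives the sums in \<open>spanned\<close>
  their meaning, as a sum over an infinite set is 0 by default.\<close>

lemma finite_FYm: "finite (Collect FYm)"
proof -
  have "size m \<le> card L * rk E" if "FYm m" for m
  proof -
    have "size m = (\<Sum>F\<in>set_mset m. count m F)" by (rule size_multiset_overloaded_eq)
    also have "\<dots> \<le> (\<Sum>F\<in>set_mset m. rk E)"
    proof (rule sum_mono)
      fix F assume "F \<in># m"
      then have "count m F \<le> rk F" "F \<subseteq> E" using that L_subset by (auto simp: FYm_def)
      then show "count m F \<le> rk E" using rk_mono[of F E] by simp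
    qed
    also have "\<dots> \<le> card L * rk E"
      using that by (auto simp: FYm_def finite_L intro!: card_mono)
    finally show ?thesis .
  qed
  then have "Collect FYm \<subseteq> (\<Union>k\<le>card L * rk E. multisets_of_size L k)"
    by (auto simp: multisets_of_size_def FYm_def)
  then show ?thesis by (rule finite_subset) (auto simp: finite_L)
qed

lemma mconst_add: "mconst (a + b) = mconst a + mconst b"
  and mconst_mult: "mconst (a * b) = mconst a * mconst b"
  and mconst_0 [simp]: "mconst 0 = 0"
  and mconst_1 [simp]: "mconst 1 = 1"
  and mconst_uminus: "mconst (- a) = - mconst a"
  by (simp_all add: mconst_def single_add mult_single single_uminus)

lemma spanned_add:
  assumes "p \<in> spanned" "q \<in> spanned" shows "p + q \<in> spanned"
proof -
  obtain c d where "p - (\<Sum>m\<in>Collect FYm. mconst (c m) * xmono m) \<in> AI"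
    "q - (\<Sum>m\<in>Collect FYm. mconst (d m) * xmono m) \<in> AI"
    using assms by (auto simp: spanned_def)
  then have "(p - (\<Sum>m\<in>Collect FYm. mconst (c m) * xmono m)) + (q - (\<Sum>m\<in>Collect FYm. mconst (d m) * xmono m)) \<in> AI"
    by (rule AI_add)
  also have "(p - (\<Sum>m\<in>Collect FYm. mconst (c m) * xmono m)) + (q - (\<Sum>m\<in>Collect FYm. mconst (d m) * xmono m))
    = p + q - (\<Sum>m\<in>Collect FYm. mconst (c m + d m) * xmono m)"
    by (simp add: mconst_add distrib_right sum.distrib)
  finally show ?thesis by (auto simp: spanned_def)
qed

lemma spanned_mconst:
  assumes "p \<in> spanned" shows "mconst a * p \<in> spanned"
proof -
  obtain c where "p - (\<Sum>m\<in>Collect FYm. mconst (c m) * xmono m) \<in> AI"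
    using assms by (auto simp: spanned_def)
  then have "mconst a * (p - (\<Sum>m\<in>Collect FYm. mconst (c m) * xmono m)) \<in> AI"
    by (rule AI_mult[OF _ mpolys_mconst])
  also have "mconst a * (p - (\<Sum>m\<in>Collect FYm. mconst (c m) * xmono m))
    = mconst a * p - (\<Sum>m\<in>Collect FYm. mconst (a * c m) * xmono m)"
    by (simp add: right_diff_distrib sum_distrib_left mconst_mult mult.assoc)
  finally show ?thesis by (auto simp: spanned_def)
qed

lemma spanned_uminus: "p \<in> spanned \<Longrightarrow> - p \<in> spanned"
  using spanned_mconst[of p "- 1"] by (simp add: mconst_uminus)

lemma spanned_diff: "p \<in> spanned \<Longrightarrow> q \<in> spanned \<Longrightarrow> p - q \<in> spanned"
  using spanned_add[of p "- q"] spanned_uminus[of q] by simp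

lemma AI_spanned: "p \<in> AI \<Longrightarrow> p \<in> spanned"
  by (auto simp: spanned_def intro!: exI[of _ "\<lambda>_. 0"])

lemma spanned_sum: "(\<And>i. i \<in> A \<Longrightarrow> f i \<in> spanned) \<Longrightarrow> (\<Sum>i\<in>A. f i) \<in> spanned"
  by (induction A rule: infinite_finite_induct) (auto simp: AI_spanned AI_0 spanned_add)

lemma FYm_spanned: "FYm m \<Longrightarrow> xmono m \<in> spanned"
  unfolding spanned_def
  by (auto simp: AI_0 finite_FYm if_distrib[of mconst] if_distrib[of "\<lambda>x. x * _"] cong: if_cong
      intro!: exI[of _ "\<lambda>k. if k = m then 1 else 0"])

text \<open>Expanding the power of \<open>hp G\<close> produces monomials of size \<open>N\<close>
  only, and every flat that is inserted has rank at least \<open>rk G\<close>.\<close>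

lemma xmono_hp_spanned:
  assumes "\<And>m'. set_mset m' \<subseteq> L \<Longrightarrow> size m' = N \<Longrightarrow> s < rksum m' \<Longrightarrow> xmono m' \<in> spanned"
    and "set_mset m \<subseteq> L" "G \<in> L" "size m + k = N" "s < rksum m + k * rk G"
  shows "xmono m * hp G ^ k \<in> spanned"
  using assms(2,4,5)
proof (induction k arbitrary: m)
  case 0
  then show ?case using assms(1) by simp
next
  case (Suc k)
  have "xmono (add_mset H m) * hp G ^ k \<in> spanned" if "H \<in> {H \<in> L. G \<subseteq> H}" for H
    by (rule Suc.IH) (use Suc.prems that rk_mono[of G H] in auto)
  then have "(\<Sum>H\<in>{H \<in> L. G \<subseteq> H}. xmono (add_mset H m) * hp G ^ k) \<in> spanned"
    by (rule spanned_sum)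
  also have "(\<Sum>H\<in>{H \<in> L. G \<subseteq> H}. xmono (add_mset H m) * hp G ^ k) = hp G * (xmono m * hp G ^ k)"
    by (subst hp_def) (simp add: sum_distrib_right mult.assoc)
  finally show ?case by (simp add: mult_ac)
qed

lemma hp_eq: "G \<in> L \<Longrightarrow> hp G = xpoly G + (\<Sum>H\<in>{H \<in> L. G \<subset> H}. xpoly H)"
  by (simp add: hp_def sum_up)

text \<open>Starting from the vanishing product with \<open>hp G ^ d\<close>, the factors h_G are
  turned into x_G one at a time. Each correction term contains a flat strictly above
  \<open>G\<close>, so its rank sum exceeds that of \<open>m\<close>.\<close>

lemma xmono_rewrite:
  assumes "\<And>m'. set_mset m' \<subseteq> L \<Longrightarrow> size m' = size m \<Longrightarrow> rksum m < rksum m' \<Longrightarrow> xmono m' \<in> spanned"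
    and "m = m1 + replicate_mset d G" "set_mset m1 \<subseteq> L" "G \<in> L" "xmono m1 * hp G ^ d \<in> AI"
  shows "xmono m \<in> spanned"
proof -
  have "xmono (m1 + replicate_mset j G) * hp G ^ (d - j) \<in> spanned" if "j \<le> d" for j
    using that
  proof (induction j)
    case 0
    then show ?case using assms(5) by (simp add: AI_spanned)
  next
    case (Suc j)
    obtain e where e: "d - j = Suc e" "d - Suc j = e" "d = Suc (j + e)"
      using Suc.prems by (metis Suc_diff_Suc Suc_le_eq add_Suc le_add_diff_inverse)
    let ?m = "m1 + replicate_mset j G"
    have "xmono (add_mset H ?m) * hp G ^ e \<in> spanned" if "H \<in> {H \<in> L. G \<subset> H}" for H
    proof (rule xmono_hp_spanned[OF assms(1)])
      have "rk G < rk H" using that flat_rk_less[OF assms(4), of H] L_subset by auto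
      then show "rksum m < rksum (add_mset H ?m) + e * rk G"
        by (simp add: assms(2) e algebra_simps)
    qed (use that assms(2-4) e in \<open>auto split: if_splits\<close>)
    then have "(\<Sum>H\<in>{H \<in> L. G \<subset> H}. xmono (add_mset H ?m) * hp G ^ e) \<in> spanned"
      by (rule spanned_sum)
    moreover have "xmono ?m * hp G ^ Suc e \<in> spanned" using Suc e by simp
    ultimately have "xmono ?m * hp G ^ Suc e - (\<Sum>H\<in>{H \<in> L. G \<subset> H}. xmono (add_mset H ?m) * hp G ^ e) \<in> spanned"
      by (intro spanned_diff)
    also have "xmono ?m * hp G ^ Suc e - (\<Sum>H\<in>{H \<in> L. G \<subset> H}. xmono (add_mset H ?m) * hp G ^ e)
      = xmono ?m * hp G ^ e * (hp G - (\<Sum>H\<in>{H \<in> L. G \<subset> H}. xpoly H))"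
      by (simp add: right_diff_distrib sum_distrib_left mult_ac)
    also have "hp G - (\<Sum>H\<in>{H \<in> L. G \<subset> H}. xpoly H) = xpoly G" using hp_eq[OF assms(4)] by simp
    finally show ?case by (simp add: e mult_ac)
  qed
  from this[of d] show ?thesis by (simp add: assms(2))
qed

lemma rksum_le: "set_mset m \<subseteq> L \<Longrightarrow> rksum m \<le> size m * rk E"
proof (induction m)
  case (add F m)
  then show ?case using rk_mono[of F E] L_subset by (simp add: add_mono)
qed simp

lemma replicate_remainder: "d \<le> count m G \<Longrightarrow> m = (m - replicate_mset d G) + replicate_mset d G"
  by (simp add: count_le_replicate_mset_subset_eq[symmetric])

text \<open>At fixed size the rank sum is bounded, so the rewriting terminates. Each way of
  violating \<open>FYm\<close> provides a relation to rewrite with or makes the monomial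
  vanish.\<close>

lemma xmono_spanned: "set_mset m \<subseteq> L \<Longrightarrow> xmono m \<in> spanned"
proof (induction "size m * rk E - rksum m" arbitrary: m rule: less_induct)
  case less
  have IH: "xmono m' \<in> spanned" if "set_mset m' \<subseteq> L" "size m' = size m" "rksum m < rksum m'" for m'
    by (rule less.hyps) (use that rksum_le[of m'] in auto)
  consider (FY) "FYm m"
    | (incomparable) F G where "F \<in># m" "G \<in># m" "\<not> F \<subseteq> G" "\<not> G \<subseteq> F"
    | (large) F where "F \<in># m" "rk F < count m F"
    | (gap) F G where "F \<in># m" "G \<in># m" "F \<subset> G" "rk G \<le> rk F + count m G"
    using less.prems unfolding FYm_def by (simp only: not_le[symmetric]) blast
  then show ?case
  proof cases
    case FY
    then show ?thesis by (rule FYm_spanned)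
  next
    case incomparable
    then have "F \<noteq> G" by auto
    then obtain m0 where m: "m = add_mset F (add_mset G m0)"
      using incomparable by (metis insert_DiffM insert_noteq_member multi_member_split)
    have "xmono m0 * (xpoly F * xpoly G) \<in> AI"
      by (rule AI_mult[OF xpoly_mult_incomparable xmono_in_AC]) (use m less.prems incomparable in auto)
    then show ?thesis by (intro AI_spanned) (simp add: m mult_ac)
  next
    case large
    let ?d = "Suc (rk F)"
    have F: "F \<in> L" using large less.prems by auto
    show ?thesis
    proof (rule xmono_rewrite[OF IH])
      show "m = (m - replicate_mset ?d F) + replicate_mset ?d F"
        by (rule replicate_remainder) (use large in simp)
      have sub: "set_mset (m - replicate_mset ?d F) \<subseteq> L" using less.prems by (auto dest: in_diffD)
      then show "set_mset (m - replicate_mset ?d F) \<subseteq> L" .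
      show "xmono (m - replicate_mset ?d F) * hp F ^ ?d \<in> AI"
        by (rule AI_mult[OF hp_power_top[OF F] xmono_in_AC[OF sub]])
    qed (use F in auto)
  next
    case gap
    let ?d = "rk G - rk F"
    have FG: "F \<in> L" "G \<in> L" using gap less.prems by auto
    let ?m = "m - replicate_mset ?d G"
    have "F \<noteq> G" using gap by auto
    \<comment> \<open>Only copies of \<open>G\<close> were removed, so a factor x_F is left for
      \<open>xpoly_hp_power\<close>.\<close>
    then have "F \<in># ?m" using gap by (simp add: in_diff_count)
    then obtain m0 where m0: "?m = add_mset F m0" by (metis multi_member_split)
    have sub: "set_mset ?m \<subseteq> L" using less.prems by (auto dest: in_diffD)
    show ?thesis
    proof (rule xmono_rewrite[OF IH])
      show "m = ?m + replicate_mset ?d G"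
        by (rule replicate_remainder) (use gap in simp)
      show "set_mset ?m \<subseteq> L" by (rule sub)
      have "xmono m0 * (xpoly F * hp G ^ ?d) \<in> AI"
        by (rule AI_mult[OF xpoly_hp_power[OF FG gap(3)] xmono_in_AC]) (use sub m0 in auto)
      then show "xmono ?m * hp G ^ ?d \<in> AI" unfolding m0 by (simp add: mult_ac)
    qed (use FG in auto)
  qed
qed

lemma AC_spanned:
  assumes "p \<in> AC" shows "p \<in> spanned"
proof -
  \<comment> \<open>The extra factor \<open>xmono m\<close> lets a new x variable be absorbed into
    \<open>m\<close>; a y variable is first replaced by a sum of x variables through
    \<open>gens3\<close>.\<close>
  have "\<forall>m. set_mset m \<subseteq> L \<longrightarrow> xmono m * p \<in> spanned"
    using assms
  proof (induction rule: mpoly_induct)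
    case (const c)
    then show ?case using spanned_mconst[OF xmono_spanned] by (simp add: mult.commute[of _ "mconst c"])
  next
    case (var p v)
    have X: "xmono m * (p * mvar (XVar F)) \<in> spanned" if "F \<in> L - {E}" "set_mset m \<subseteq> L" for F m
    proof -
      have "set_mset (add_mset F m) \<subseteq> L" using that by simp
      then have "xmono (add_mset F m) * p \<in> spanned" using var.IH by blast
      then show ?thesis using that by (simp add: xpoly_def mult_ac)
    qed
    show ?case
    proof (intro allI impI)
      fix m :: "'a set multiset" assume m: "set_mset m \<subseteq> L"
      show "xmono m * (p * mvar v) \<in> spanned"
      proof (cases v)
        case (XVar F)
        then show ?thesis using var.hyps(2) X m by (auto simp: aug_vars_def)
      next
        case (YVar i)
        then have i: "i \<in> E" using var.hyps(2) by (auto simp: aug_vars_def)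
        let ?A = "{F \<in> L - {E}. i \<notin> F}"
        have "mvar v - (\<Sum>F\<in>?A. mvar (XVar F)) \<in> AI"
          using gens_in_AI(3) i YVar by (auto simp: gens3_def)
        then have "(xmono m * p) * (mvar v - (\<Sum>F\<in>?A. mvar (XVar F))) \<in> AI"
          by (rule AI_mult[OF _ mpolys_mult[OF xmono_in_AC[OF m] var.hyps(1)]])
        then have "(xmono m * p) * (mvar v - (\<Sum>F\<in>?A. mvar (XVar F))) \<in> spanned"
          by (rule AI_spanned)
        moreover have "(\<Sum>F\<in>?A. xmono m * (p * mvar (XVar F))) \<in> spanned"
          by (rule spanned_sum) (use X m in auto)
        ultimately have "(xmono m * p) * (mvar v - (\<Sum>F\<in>?A. mvar (XVar F))) + (\<Sum>F\<in>?A. xmono m * (p * mvar (XVar F))) \<in> spanned"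
          by (rule spanned_add)
        then show ?thesis by (simp add: right_diff_distrib sum_distrib_left mult.assoc)
      qed
    qed
  next
    case (add p q)
    then show ?case by (simp add: distrib_left spanned_add)
  qed
  from this[rule_format, of "{#}"] show ?thesis by simp
qed

section \<open>Passage to the quotient ring\<close>

abbreviation AQ :: "'a aug_var mpoly_rat set ring" where "AQ \<equiv> aug_chow_ring E indep"
abbreviation acls :: "'a aug_var mpoly_rat \<Rightarrow> 'a aug_var mpoly_rat set" where "acls \<equiv> aug_class E indep"

lemma AQ_cring: "cring AQ"
  unfolding aug_chow_ring_def by (rule AI.quotient_is_cring[OF AP_cring])

sublocale AQ: cring AQ
  by (rule AQ_cring)

lemma acls_hom: "acls \<in> ring_hom AP AQ"
  using AI.rcos_ring_hom unfolding aug_chow_ring_def aug_class_def[abs_def] .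

lemma acls_simps:
  assumes "p \<in> AC" "q \<in> AC"
  shows acls_add: "acls (p + q) = acls p \<oplus>\<^bsub>AQ\<^esub> acls q"
    and acls_mult: "acls (p * q) = acls p \<otimes>\<^bsub>AQ\<^esub> acls q"
  using ring_hom_add[OF acls_hom] ring_hom_mult[OF acls_hom] assms by auto

lemma acls_1: "acls 1 = \<one>\<^bsub>AQ\<^esub>"
  using ring_hom_one[OF acls_hom] by simp

lemma acls_closed: "p \<in> AC \<Longrightarrow> acls p \<in> carrier AQ"
  using ring_hom_closed[OF acls_hom] by simp

lemma carrier_AQ: "carrier AQ = acls ` AC"
  by (auto simp: aug_chow_ring_def FactRing_def A_RCOSETS_def' aug_class_def)

lemma acls_eq_iff: "p \<in> AC \<Longrightarrow> q \<in> AC \<Longrightarrow> acls p = acls q \<longleftrightarrow> p - q \<in> AI"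
  using AP.quotient_eq_iff_same_a_r_cos[OF AI_ideal, of p q]
    mpoly_ring_minus[of p "aug_vars E indep" q]
  by (simp add: aug_class_def aug_poly_ring_def)

lemma acls_0: "acls 0 = \<zero>\<^bsub>AQ\<^esub>"
proof -
  have "acls 0 \<oplus>\<^bsub>AQ\<^esub> acls 0 = acls 0" using acls_add[OF mpolys_0 mpolys_0] by simp
  then show ?thesis using acls_closed[OF mpolys_0] AQ.add.l_cancel_one by blast
qed

lemma acls_uminus: "p \<in> AC \<Longrightarrow> acls (- p) = \<ominus>\<^bsub>AQ\<^esub> acls p"
  using acls_add[of "- p" p] by (intro AQ.minus_equality[symmetric])
    (auto simp: acls_closed mpolys_uminus acls_0)

lemma acls_sum:
  assumes "finite A" "\<And>i. i \<in> A \<Longrightarrow> f i \<in> AC"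
  shows "acls (\<Sum>i\<in>A. f i) = (\<Oplus>\<^bsub>AQ\<^esub>i\<in>A. acls (f i))"
  using assms
proof (induction A)
  case empty
  then show ?case by (simp add: acls_0)
next
  case (insert i A)
  then show ?case
    by (simp add: acls_add mpolys_sum) (subst AQ.finsum_insert, auto simp: acls_closed)
qed

lemma acls_power: "p \<in> AC \<Longrightarrow> acls (p ^ k) = acls p [^]\<^bsub>AQ\<^esub> k"
proof (induction k)
  case 0
  then show ?case by (simp add: acls_1)
next
  case (Suc k)
  then show ?case using acls_mult[of "p ^ k" p] by (simp add: mpolys_power mult.commute)
qed

lemma aug_x_eq: "F \<in> L \<Longrightarrow> aug_x E indep F = acls (xpoly F)"
proof (cases "F = E")
  case True
  have "acls (\<Sum>G\<in>L - {E}. mvar (XVar G)) = (\<Oplus>\<^bsub>AQ\<^esub>G\<in>L - {E}. acls (mvar (XVar G)))"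
    by (rule acls_sum) (use finite_L mvar_XVar_in_AC in auto)
  moreover have "(\<Sum>G\<in>L - {E}. mvar (XVar G)) \<in> AC" by (rule mpolys_sum) (rule mvar_XVar_in_AC)
  ultimately show ?thesis using True by (simp add: aug_x_def xpoly_def acls_uminus)
qed (simp add: aug_x_def xpoly_def)

section \<open>Correspondence between exponent lists and multisets\<close>

definition expand :: "('a set \<times> nat) list \<Rightarrow> 'a set multiset"
  where "expand ps = (\<Sum>(F, a)\<leftarrow>ps. replicate_mset a F)"

lemma expand_simps [simp]: "expand [] = {#}" "expand ((F, a) # ps) = replicate_mset a F + expand ps"
  by (simp_all add: expand_def)

lemma FY_monomial_eq:
  "(\<And>p. p \<in> set ps \<Longrightarrow> fst p \<in> L) \<Longrightarrow> FY_monomial E indep ps = acls (xmono (expand ps))"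
proof (induction ps)
  case Nil
  then show ?case by (simp add: FY_monomial_def acls_1)
next
  case (Cons p ps)
  obtain F a where p: "p = (F, a)" by (cases p)
  have F: "F \<in> L" using Cons.prems[of p] p by simp
  have e: "set_mset (expand qs) \<subseteq> L" if "\<And>p. p \<in> set qs \<Longrightarrow> fst p \<in> L" for qs
    using that
  proof (induction qs)
    case (Cons q qs)
    then show ?case using Cons.prems[of q] by (cases q) auto
  qed simp
  have "xmono (expand ps) \<in> AC" by (rule xmono_in_AC, rule e) (use Cons.prems in auto)
  then show ?case
    using Cons F p by (simp add: FY_monomial_def aug_x_eq acls_mult acls_power mpolys_power xpoly_in_AC)
qed

lemma sorted_psubset_unique:
  assumes "sorted_wrt (\<subset>) xs" "sorted_wrt (\<subset>) ys" "set xs = set ys"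
  shows "xs = (ys :: 'a set list)"
  using assms
proof (induction xs arbitrary: ys)
  case (Cons x xs)
  then obtain y ys' where ys: "ys = y # ys'" by (cases ys) auto
  have lt: "\<And>z. z \<in> set xs \<Longrightarrow> x \<subset> z" "\<And>z. z \<in> set ys' \<Longrightarrow> y \<subset> z"
    using Cons.prems unfolding ys by simp_all
  have eq: "insert x (set xs) = insert y (set ys')" using Cons.prems unfolding ys by simp
  have xy: "x = y"
  proof (rule ccontr)
    assume "x \<noteq> y"
    then have "x \<in> set ys'" "y \<in> set xs" using eq by blast+
    then show False using lt(1)[of y] lt(2)[of x] by blast
  qed
  have "x \<notin> set xs" "x \<notin> set ys'" using lt xy by blast+
  then have "set xs = set ys'" using eq xy by (simp add: insert_ident)
  then have "xs = ys'" using Cons.IH[of ys'] Cons.prems unfolding ys by simp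
  then show ?case using xy ys by simp
qed simp

lemma set_expand: "(\<And>p. p \<in> set ps \<Longrightarrow> 1 \<le> snd p) \<Longrightarrow> set_mset (expand ps) = fst ` set ps"
proof (induction ps)
  case (Cons p ps)
  then show ?case using Cons.prems[of p] by (cases p) simp
qed simp

lemma count_expand: "distinct (map fst ps) \<Longrightarrow> (F, a) \<in> set ps \<Longrightarrow> count (expand ps) F = a"
proof (induction ps)
  case (Cons p ps)
  have zero: "count (expand qs) G = 0" if "G \<notin> fst ` set qs" for qs G
    using that
  proof (induction qs)
    case (Cons q qs)
    then show ?case by (cases q) simp
  qed simp
  obtain G b where p: "p = (G, b)" by (cases p)
  show ?case
  proof (cases "(F, a) = p")
    case True
    then show ?thesis using Cons.prems zero[of F ps] by (simp add: p)
  next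
    case False
    then have "(F, a) \<in> set ps" using Cons.prems by simp
    moreover from this have "F \<noteq> G" using Cons.prems by (force simp: p)
    ultimately show ?thesis using Cons by (simp add: p)
  qed
qed simp

lemma FY_data_sorted:
  assumes "ps \<in> FY_data E indep" shows "sorted_wrt (\<subset>) (map fst ps)"
  using assms by (auto simp: FY_data_def sorted_wrt_iff_nth_Suc_transp transp_def)

lemma sorted_psubset_distinct: "sorted_wrt (\<subset>) (xs :: 'a set list) \<Longrightarrow> distinct xs"
  by (induction xs) auto

lemma FYm_expand:
  assumes ps: "ps \<in> FY_data E indep" shows "FYm (expand ps)"
proof -
  have sorted: "sorted_wrt (\<subset>) (map fst ps)" by (rule FY_data_sorted[OF ps])
  then have dist: "distinct (map fst ps)" by (rule sorted_psubset_distinct)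
  have fl: "fst (ps ! i) \<in> L" "1 \<le> snd (ps ! i)" if "i < length ps" for i
    using ps nth_mem[OF that] by (auto simp: FY_data_def)
  have set: "set_mset (expand ps) = fst ` set ps"
    by (rule set_expand) (use ps in \<open>auto simp: FY_data_def\<close>)
  have cnt: "count (expand ps) (fst (ps ! i)) = snd (ps ! i)" if "i < length ps" for i
    by (rule count_expand[OF dist]) (use that in simp)
  have lt: "fst (ps ! i) \<subset> fst (ps ! j)" if "i < j" "j < length ps" for i j
    using sorted that by (auto simp: sorted_wrt_iff_nth_less)
  have zero: "snd (ps ! 0) \<le> rk (fst (ps ! 0))" if "0 < length ps"
    using ps that by (auto simp: FY_data_def)
  have suc: "snd (ps ! Suc k) \<le> rk (fst (ps ! Suc k)) - rk (fst (ps ! k)) - 1" if "Suc k < length ps" for k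
    using ps that by (auto simp: FY_data_def)
  have ex: "\<exists>i<length ps. F = fst (ps ! i)" if "F \<in># expand ps" for F
    using that unfolding set by (metis imageE in_set_conv_nth)
  have "F \<in> L \<and> count (expand ps) F \<le> rk F" if F: "F \<in># expand ps" for F
  proof -
    obtain i where i: "i < length ps" "F = fst (ps ! i)" using ex[OF F] by blast
    have "snd (ps ! i) \<le> rk (fst (ps ! i))"
      using zero suc[of "i - 1"] i by (cases i) auto
    then show ?thesis using fl cnt i by simp
  qed
  moreover have "F \<subseteq> G \<or> G \<subseteq> F" if F: "F \<in># expand ps" and G: "G \<in># expand ps" for F G
  proof -
    obtain i j where "i < length ps" "F = fst (ps ! i)" "j < length ps" "G = fst (ps ! j)"
      using ex[OF F] ex[OF G] by blast
    then show ?thesis using lt[of i j] lt[of j i] by (cases i j rule: linorder_cases) auto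
  qed
  moreover have "rk F + count (expand ps) G < rk G" if F: "F \<in># expand ps" and G: "G \<in># expand ps" "F \<subset> G" for F G
  proof -
    obtain i j where ij: "i < length ps" "F = fst (ps ! i)" "j < length ps" "G = fst (ps ! j)"
      using ex[OF F] ex[OF G(1)] by blast
    have "i < j" using lt[of j i] G(2) ij by (cases i j rule: linorder_cases) auto
    \<comment> \<open>The list conditions concern consecutive entries; the immediate predecessor
      \<open>k\<close> of \<open>j\<close> has rank at least \<open>rk F\<close>, which gives the
      condition for the pair.\<close>
    then obtain k where k: "j = Suc k" "i \<le> k" by (cases j) auto
    have "fst (ps ! i) \<subseteq> fst (ps ! k)" using lt[of i k] k ij by (cases "i = k") auto
    then have "rk F \<le> rk (fst (ps ! k))" using ij by (simp add: rk_mono)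
    then show ?thesis using suc[of k] fl(2)[of j] cnt[of j] ij k by simp
  qed
  ultimately show ?thesis by (auto simp: FYm_def)
qed

lemma inj_expand: "inj_on expand (FY_data E indep)"
proof (rule inj_onI)
  fix ps qs assume *: "ps \<in> FY_data E indep" "qs \<in> FY_data E indep" "expand ps = expand qs"
  have set: "set_mset (expand rs) = fst ` set rs" if "rs \<in> FY_data E indep" for rs
    by (rule set_expand) (use that in \<open>auto simp: FY_data_def\<close>)
  \<comment> \<open>The multiset determines the list: its flats in increasing order, paired with
    their multiplicities.\<close>
  have rs: "rs = map (\<lambda>F. (F, count (expand rs) F)) (map fst rs)" if "rs \<in> FY_data E indep" for rs
    using count_expand[OF sorted_psubset_distinct[OF FY_data_sorted[OF that]]]
    by (auto simp: o_def intro!: map_idI[symmetric] prod_eqI)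
  have "map fst ps = map fst qs"
    by (rule sorted_psubset_unique) (use * FY_data_sorted set in \<open>auto simp flip: set\<close>)
  then show "ps = qs" using rs[OF *(1)] rs[OF *(2)] *(3) by metis
qed

lemma desc_sorted: "desc F cs \<Longrightarrow> sorted_wrt (\<lambda>x y. y \<subset> x) (F # cs)"
proof (induction F cs rule: desc.induct)
  case (2 F G cs)
  then show ?case by auto
qed simp

lemma expand_count_map:
  assumes "distinct xs" "set xs = set_mset m" shows "expand (map (\<lambda>F. (F, count m F)) xs) = m"
proof (rule multiset_eqI)
  fix F
  show "count (expand (map (\<lambda>F. (F, count m F)) xs)) F = count m F"
  proof (cases "F \<in> set xs")
    case True
    then show ?thesis using assms by (intro count_expand) (auto simp: o_def)
  next
    case False
    moreover have "set_mset (expand (map (\<lambda>F. (F, count m F)) xs)) = fst ` set (map (\<lambda>F. (F, count m F)) xs)"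
      by (rule set_expand) (use assms in auto)
    ultimately have "F \<notin># expand (map (\<lambda>F. (F, count m F)) xs)" "F \<notin># m"
      using assms by (auto simp: image_image)
    then show ?thesis by (simp add: not_in_iff)
  qed
qed

lemma expand_surj:
  assumes "FYm m" shows "m \<in> expand ` FY_data E indep"
proof -
  have mL: "set_mset m \<subseteq> L" using assms by (simp add: FYm_def)
  have "\<exists>cs. desc E cs \<and> set cs = set_mset m - {E}"
    by (rule chain_desc) (use assms L_subset in \<open>auto simp: FYm_def\<close>)
  then obtain cs where cs: "desc E cs" "set cs = set_mset m - {E}" by blast
  \<comment> \<open>Reversing the descending chain gives increasing order. The flat \<open>E\<close>
    is the start of the chain but not an entry of \<open>cs\<close>, so it is appended when it
    occurs in \<open>m\<close>.\<close>
  define xs where "xs = rev cs @ (if E \<in># m then [E] else [])"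
  have sorted: "sorted_wrt (\<subset>) xs"
    using desc_sorted[OF cs(1)] by (auto simp: xs_def sorted_wrt_append sorted_wrt_rev)
  have set: "set xs = set_mset m" using cs(2) by (auto simp: xs_def)
  define ps where "ps = map (\<lambda>F. (F, count m F)) xs"
  have mem: "xs ! i \<in># m" if "i < length xs" for i using nth_mem[OF that] set by simp
  have "ps \<in> FY_data E indep"
    unfolding FY_data_def mem_Collect_eq
  proof (intro conjI allI impI)
    show "\<forall>(F, a)\<in>set ps. F \<in> L \<and> 1 \<le> a"
      using set mL by (auto simp: ps_def Suc_le_eq)
    assume "ps \<noteq> []"
    then have x0: "xs ! 0 \<in># m" "0 < length xs" using mem by (auto simp: ps_def)
    then have c: "count m (xs ! 0) \<le> rk (xs ! 0)" "0 < count m (xs ! 0)"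
      using assms by (auto simp: FYm_def)
    \<comment> \<open>The empty set has rank 0 and leaves no room for a positive exponent.\<close>
    then have "xs ! 0 \<noteq> {}" by (metis rk_empty less_le_not_le)
    then show "{} \<subset> fst (ps ! 0)" "snd (ps ! 0) \<le> rk (fst (ps ! 0))"
      using x0 c(1) by (auto simp: ps_def)
  next
    fix i assume i: "Suc i < length ps"
    then have lt: "xs ! i \<subset> xs ! Suc i"
      using sorted by (simp add: ps_def sorted_wrt_iff_nth_less)
    then show "fst (ps ! i) \<subset> fst (ps ! Suc i)" using i by (simp add: ps_def)
    have "rk (xs ! i) + count m (xs ! Suc i) < rk (xs ! Suc i)"
      using assms lt mem[of i] mem[of "Suc i"] i by (auto simp: FYm_def ps_def)
    then show "snd (ps ! Suc i) \<le> rk (fst (ps ! Suc i)) - rk (fst (ps ! i)) - 1"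
      using i by (simp add: ps_def)
  qed
  moreover have "expand ps = m"
    unfolding ps_def by (rule expand_count_map[OF sorted_psubset_distinct[OF sorted] set])
  ultimately show ?thesis by blast
qed

lemma expand_image: "expand ` FY_data E indep = Collect FYm"
  using FYm_expand expand_surj by auto

lemma FY_monomial_expand: "ps \<in> FY_data E indep \<Longrightarrow> FY_monomial E indep ps = acls (xmono (expand ps))"
  by (rule FY_monomial_eq) (auto simp: FY_data_def)

section \<open>Linear independence, spanning and the basis\<close>

abbreviation fy :: "'a set multiset \<Rightarrow> 'a aug_var mpoly_rat set" where "fy m \<equiv> acls (xmono m)"

lemma Span_fy:
  assumes "set ms \<subseteq> {m. set_mset m \<subseteq> L}" "distinct ms"
  shows "ring.Span AQ (aug_scalars E indep) (map fy ms)
    = {acls (\<Sum>m\<in>set ms. mconst (c m) * xmono m) | c. True}"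
  using assms
proof (induction ms)
  case Nil
  then show ?case by (simp add: AQ.Span.simps acls_0)
next
  case (Cons m ms)
  let ?K = "aug_scalars E indep"
  have in_AC: "mconst a * xmono m \<in> AC" "(\<Sum>m\<in>set ms. mconst (c m) * xmono m) \<in> AC" for a c
    using Cons.prems by (auto intro!: mpolys_sum mpolys_mult mpolys_mconst xmono_in_AC)
  have IH: "AQ.Span ?K (map fy ms) = {acls (\<Sum>m\<in>set ms. mconst (c m) * xmono m) | c. True}"
    by (rule Cons.IH) (use Cons.prems in auto)
  have "AQ.Span ?K (map fy (m # ms)) = AQ.line_extension ?K (fy m) (AQ.Span ?K (map fy ms))"
    by simp
  also have "\<dots> = {acls (mconst a) \<otimes>\<^bsub>AQ\<^esub> fy m \<oplus>\<^bsub>AQ\<^esub> acls (\<Sum>m\<in>set ms. mconst (c m) * xmono m) | a c. True}"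
    unfolding IH AQ.line_extension_def by (auto simp: set_add_def' r_coset_def aug_scalars_def)
  also have "\<dots> = {acls (mconst a * xmono m + (\<Sum>m\<in>set ms. mconst (c m) * xmono m)) | a c. True}"
    using in_AC Cons.prems xmono_in_AC by (simp add: acls_add acls_mult mpolys_mconst)
  also have "\<dots> = {acls (\<Sum>m\<in>set (m # ms). mconst (c m) * xmono m) | c. True}"
  proof -
    \<comment> \<open>Updating \<open>c\<close> at the new monomial merges the scalar
      \<open>a\<close> with the coefficients on \<open>ms\<close>.\<close>
    have "(\<Sum>m\<in>set ms. mconst ((c(m' := a)) m) * xmono m) = (\<Sum>m\<in>set ms. mconst (c m) * xmono m)"
      if "m' \<notin> set ms" for m' a c
      by (rule sum.cong) (use that in auto)
    then have 1: "mconst a * xmono m + (\<Sum>m\<in>set ms. mconst (c m) * xmono m)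
        = (\<Sum>k\<in>set (m # ms). mconst ((c(m := a)) k) * xmono k)" for a c
      using Cons.prems by simp
    have 2: "(\<Sum>k\<in>set (m # ms). mconst (c k) * xmono k)
        = mconst (c m) * xmono m + (\<Sum>m\<in>set ms. mconst (c m) * xmono m)" for c
      using Cons.prems by simp
    show ?thesis (is "?A = ?B")
    proof
      show "?A \<subseteq> ?B" unfolding 1 by blast
      show "?B \<subseteq> ?A" unfolding 2 by blast
    qed
  qed
  finally show ?case .
qed

lemma independent_fy:
  assumes "\<And>m. m \<in> set ms \<Longrightarrow> FYm m" "distinct ms"
  shows "ring.independent AQ (aug_scalars E indep) (map fy ms)"
  using assms
proof (induction ms)
  case Nil
  then show ?case by simp
next
  case (Cons m ms)
  have L: "set_mset k \<subseteq> L" if "k \<in> set (m # ms)" for k using Cons.prems(1)[OF that] by (simp add: FYm_def)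
  have "fy m \<notin> AQ.Span (aug_scalars E indep) (map fy ms)"
  proof
    assume "fy m \<in> AQ.Span (aug_scalars E indep) (map fy ms)"
    then obtain c where c: "fy m = acls (\<Sum>k\<in>set ms. mconst (c k) * xmono k)"
      using Span_fy[of ms] L Cons.prems by auto
    have "(\<Sum>k\<in>set ms. mconst (c k) * xmono k) \<in> AC"
      using L by (auto intro!: mpolys_sum mpolys_mult mpolys_mconst xmono_in_AC)
    \<comment> \<open>This is a linear relation modulo the ideal whose coefficient at
      \<open>m\<close> is 1.\<close>
    then have "xmono m - (\<Sum>k\<in>set ms. mconst (c k) * xmono k) \<in> AI"
      using c acls_eq_iff xmono_in_AC L by simp
    also have "xmono m - (\<Sum>k\<in>set ms. mconst (c k) * xmono k)
        = (\<Sum>k\<in>set (m # ms). mconst (if k = m then 1 else - c k) * xmono k)"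
    proof -
      have "(\<Sum>k\<in>set ms. mconst (if k = m then 1 else - c k) * xmono k) = (\<Sum>k\<in>set ms. - (mconst (c k) * xmono k))"
        by (rule sum.cong) (use Cons.prems(2) in \<open>auto simp: mconst_uminus\<close>)
      then show ?thesis using Cons.prems(2) by (simp add: sum_negf)
    qed
    finally have "(if m = m then 1 else - c m) = (0::rat)"
      by (intro xmono_independent[where S = "set (m # ms)"]) (use Cons.prems in auto)
    then show False by simp
  qed
  then show ?case
    using Cons L xmono_in_AC acls_closed by (auto intro!: AQ.li_Cons)
qed

lemma inj_fy: "inj_on fy (Collect FYm)"
proof (rule inj_onI)
  fix p q assume *: "p \<in> Collect FYm" "q \<in> Collect FYm" "fy p = fy q"
  show "p = q"
  proof (rule ccontr)
    assume ne: "p \<noteq> q"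
    have "xmono p - xmono q \<in> AI"
      using * acls_eq_iff xmono_in_AC by (auto simp: FYm_def)
    also have "xmono p - xmono q = (\<Sum>k\<in>{p, q}. mconst (if k = p then 1 else - 1) * xmono k)"
      using ne by (simp add: mconst_uminus)
    finally have "(if p = p then 1 else - 1) = (0::rat)"
      by (intro xmono_independent[where S = "{p, q}"]) (use * in auto)
    then show False by simp
  qed
qed

text \<open>Injectivity holds in two stages: a list is recovered from its multiset, and equal
  classes of two different monomials would be a relation with coefficients 1 and -1.\<close>

theorem FY_basis:
  "inj_on (FY_monomial E indep) (FY_data E indep)
   \<and> is_basis_over AQ (aug_scalars E indep) (FY E indep)"
proof
  have "inj_on (fy \<circ> expand) (FY_data E indep)"
    by (rule comp_inj_on[OF inj_expand]) (simp add: expand_image inj_fy)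
  then show "inj_on (FY_monomial E indep) (FY_data E indep)"
    by (simp add: inj_on_def FY_monomial_expand)
next
  obtain ms where ms: "set ms = Collect FYm" "distinct ms"
    using finite_distinct_list[OF finite_FYm] by blast
  have FY: "FY E indep = fy ` Collect FYm"
    unfolding FY_def expand_image[symmetric] image_image
    by (rule image_cong) (auto simp: FY_monomial_expand)
  have L: "set_mset m \<subseteq> L" if "m \<in> set ms" for m using ms that by (auto simp: FYm_def)
  have "AQ.Span (aug_scalars E indep) (map fy ms) = carrier AQ"
  proof -
    have sum_AC: "(\<Sum>m\<in>set ms. mconst (c m) * xmono m) \<in> AC" for c
      using L by (intro mpolys_sum mpolys_mult mpolys_mconst xmono_in_AC)
    have "\<exists>c. acls p = acls (\<Sum>m\<in>set ms. mconst (c m) * xmono m)" if "p \<in> AC" for p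
      using AC_spanned[OF that] acls_eq_iff[OF that sum_AC] by (auto simp: spanned_def ms)
    moreover have "set ms \<subseteq> {m. set_mset m \<subseteq> L}" using L by blast
    ultimately show ?thesis
      unfolding Span_fy[OF \<open>set ms \<subseteq> _\<close> ms(2)] carrier_AQ using sum_AC by blast
  qed
  moreover have "AQ.independent (aug_scalars E indep) (map fy ms)"
    by (rule independent_fy) (use ms in auto)
  moreover have "distinct (map fy ms)" using ms inj_fy by (simp add: distinct_map)
  moreover have "set (map fy ms) = FY E indep" using FY ms by simp
  ultimately show "is_basis_over AQ (aug_scalars E indep) (FY E indep)"
    unfolding is_basis_over_def by blast
qed

end

theorem corollary5p11:
  fixes n :: nat and indep :: "nat set \<Rightarrow> bool"
  assumes "matroid {1..n} indep"
  shows "inj_on (FY_monomial {1..n} indep) (FY_data {1..n} indep)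
       \<and> is_basis_over (aug_chow_ring {1..n} indep) (aug_scalars {1..n} indep) (FY {1..n} indep)"
  by (rule matroid.FY_basis[OF assms])

end
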